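(* Let $G$ be a finite almost simple group, let $K$ be a $2$-closed group with $G^*\le K\le\mathrm{Sym}(G)$, and suppose $K$ is of symmetric type. Let $U/L$ be the principal $K$-section of $G$ with associated partitions $\mathfrak U,\mathfrak L$. Then $\mathfrak L=\mathfrak U$ and $(K_{\mathfrak L})^L=\mathrm{Sym}(L)$. In particular, $K$ is permutation isomorphic to the wreath product $\mathrm{Sym}(L)\wr K^{\mathfrak L}$ in imprimitive action.
   Context: $G$ is almost simple if $\mathrm{soc}(G)$ is a nonabelian simple group. For $L\le G$, $L_{left}$, $L_{right}$ are the groups of permutations $g\mapsto xg$, $g\mapsto gx$ ($x\in L$), $L^*=L_{left}L_{right}$; $D(2,L)\le\mathrm{Sym}(L)$ is generated by $N_{\mathrm{Sym}(L)}(L_{right})$ and $x\mapsto x^{-1}$. $K$ is $2$-closed if every permutation preserving each orbit of $K$ on $G\times G$ lies in $K$. For $H\subseteq G$, $K^H$ is the group induced on $H$ by the setwise stabilizer of $H$ in $K$. For an imprimitivity system $\mathfrak L$, $K_{\mathfrak L}$ is the subgroup of $K$ fixing each block setwise, $(K_{\mathfrak L})^Z$ its restriction to a union $Z$ of blocks, and $K^{\mathfrak L}$ the group induced by $K$ on $\mathfrak L$. Principal section: the minimal block $L$ is the intersection of all blocks of imprimitivity of $K$ containing $1$ with more than one element (a normal subgroup of $G$); $\mathfrak L$ is the imprimitivity system containing $L$; for $X,X'\in\mathfrak L$, $X\sim X'$ if both restrictions $(K_{\mathfrak L})^{X\cup X'}\to(K_{\mathfrak L})^X$, $(K_{\mathfrak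 L})^{X\cup X'}\to(K_{\mathfrak L})^{X'}$ are isomorphisms; $U$ is the union of the $\sim$-class of $L$ (a normal subgroup, $L\trianglelefteq U\trianglelefteq G$) and $\mathfrak U$ the imprimitivity system containing $U$. $K$ is of symmetric type if $K^L\ge\mathrm{Alt}(L)$, or $G\cong\mathrm{Sym}(5)$ and $K\cong\mathrm{Sp}_8(2)$ acting $2$-transitively. *)

theory Defs
  imports
    "HOL-Algebra.SimpleGroups"
    "HOL-Algebra.Group_Action"
    "HOL-Algebra.Sym_Groups"
    "HOL-Library.Z2"
    "Jordan_Normal_Form.Matrix"
begin

section \<open>Almost simple groups\<close>

definition minimal_normal :: "('a, 'b) monoid_scheme \<Rightarrow> 'a set \<Rightarrow> bool" where
  "minimal_normal G N \<longleftrightarrow>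
     N \<lhd> G \<and> N \<noteq> {\<one>\<^bsub>G\<^esub>} \<and> (\<forall>M. M \<lhd> G \<and> M \<subseteq> N \<longrightarrow> M = {\<one>\<^bsub>G\<^esub>} \<or> M = N)"

definition socle :: "('a, 'b) monoid_scheme \<Rightarrow> 'a set" where
  "socle G = generate G (\<Union>{N. minimal_normal G N})"

definition almost_simple :: "('a, 'b) monoid_scheme \<Rightarrow> bool" where
  "almost_simple G \<longleftrightarrow>
     group G \<and> simple_group (G\<lparr>carrier := socle G\<rparr>) \<and> \<not> comm_group (G\<lparr>carrier := socle G\<rparr>)"


section \<open>Permutation groups\<close>

text \<open>A permutation group on \<open>\<Omega>\<close> is a set \<open>K\<close> with \<open>subgroup K (BijGroup \<Omega>)\<close>; its elements are
  undefined outside \<open>\<Omega>\<close>, so they always have to be restricted to the set they act on.\<close>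

definition perm_group :: "'a set \<Rightarrow> ('a \<Rightarrow> 'a) set \<Rightarrow> ('a \<Rightarrow> 'a) monoid" where
  "perm_group \<Omega> K = (BijGroup \<Omega>)\<lparr>carrier := K\<rparr>"

definition alternating :: "'a set \<Rightarrow> ('a \<Rightarrow> 'a) set" where
  "alternating \<Omega> = {restrict p \<Omega> | p. p permutes \<Omega> \<and> evenperm p}"

definition left_mults :: "('a, 'b) monoid_scheme \<Rightarrow> ('a \<Rightarrow> 'a) set" where
  "left_mults G = {\<lambda>g\<in>carrier G. x \<otimes>\<^bsub>G\<^esub> g | x. x \<in> carrier G}"

definition right_mults :: "('a, 'b) monoid_scheme \<Rightarrow> ('a \<Rightarrow> 'a) set" where
  "right_mults G = {\<lambda>g\<in>carrier G. g \<otimes>\<^bsub>G\<^esub> x | x. x \<in> carrier G}"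

definition star_group :: "('a, 'b) monoid_scheme \<Rightarrow> ('a \<Rightarrow> 'a) set" where
  "star_group G = left_mults G <#>\<^bsub>BijGroup (carrier G)\<^esub> right_mults G"

definition two_closed :: "'a set \<Rightarrow> ('a \<Rightarrow> 'a) set \<Rightarrow> bool" where
  "two_closed \<Omega> K \<longleftrightarrow>
     (\<forall>\<sigma>\<in>Bij \<Omega>.
        (\<forall>S\<in>orbits (perm_group \<Omega> K) (\<Omega> \<times> \<Omega>) (\<lambda>k. map_prod k k). map_prod \<sigma> \<sigma> ` S = S)
        \<longrightarrow> \<sigma> \<in> K)"

definition two_transitive :: "'a set \<Rightarrow> ('a \<Rightarrow> 'a) set \<Rightarrow> bool" where
  "two_transitive \<Omega> K \<longleftrightarrow>
     (\<forall>x\<in>\<Omega>. \<forall>y\<in>\<Omega>. \<forall>u\<in>\<Omega>. \<forall>v\<in>\<Omega>.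
        x \<noteq> y \<and> u \<noteq> v \<longrightarrow> (\<exists>k\<in>K. k x = u \<and> k y = v))"

text \<open>\<open>induced_on K H\<close> is \<open>K\<^sup>H\<close>, induced by the setwise stabilizer of \<open>H\<close>. If \<open>K\<close> fixes \<open>H\<close> setwise, as a
  block kernel does for every union of blocks, it is the plain restriction of \<open>K\<close> to \<open>H\<close>.\<close>

definition induced_on :: "('a \<Rightarrow> 'a) set \<Rightarrow> 'a set \<Rightarrow> ('a \<Rightarrow> 'a) set" where
  "induced_on K H = (\<lambda>k. restrict k H) ` {k \<in> K. k ` H = H}"

definition perm_isomorphic ::
  "'a set \<Rightarrow> ('a \<Rightarrow> 'a) set \<Rightarrow> 'b set \<Rightarrow> ('b \<Rightarrow> 'b) set \<Rightarrow> bool" where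
  "perm_isomorphic \<Omega> K \<Omega>' K' \<longleftrightarrow>
     (\<exists>f \<phi>. bij_betw f \<Omega> \<Omega>' \<and> \<phi> \<in> iso (perm_group \<Omega> K) (perm_group \<Omega>' K') \<and>
        (\<forall>k\<in>K. \<forall>x\<in>\<Omega>. f (k x) = \<phi> k (f x)))"

text \<open>The wreath product of \<open>H \<le> Sym(\<Delta>)\<close> by \<open>Q \<le> Sym(\<Omega>)\<close> in its imprimitive action
  on \<open>\<Delta> \<times> \<Omega>\<close>; the base group consists of the families \<open>h\<close>.\<close>

definition imprimitive_wreath ::
  "'a set \<Rightarrow> ('a \<Rightarrow> 'a) set \<Rightarrow> 'b set \<Rightarrow> ('b \<Rightarrow> 'b) set \<Rightarrow> ('a \<times> 'b \<Rightarrow> 'a \<times> 'b) set" where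
  "imprimitive_wreath \<Delta> H \<Omega> Q =
     {\<lambda>(\<delta>, \<omega>)\<in>\<Delta> \<times> \<Omega>. (h \<omega> \<delta>, q \<omega>) | h q. h \<in> \<Omega> \<rightarrow> H \<and> q \<in> Q}"


section \<open>Imprimitivity systems\<close>

text \<open>The whole set \<open>\<Omega>\<close> and the singletons are (trivial) blocks.\<close>

definition block :: "'a set \<Rightarrow> ('a \<Rightarrow> 'a) set \<Rightarrow> 'a set \<Rightarrow> bool" where
  "block \<Omega> K B \<longleftrightarrow> B \<subseteq> \<Omega> \<and> B \<noteq> {} \<and> (\<forall>k\<in>K. k ` B = B \<or> k ` B \<inter> B = {})"

text \<open>For transitive \<open>K\<close>, the images of a block \<open>B\<close> form the unique imprimitivity system
  containing \<open>B\<close>.\<close>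

definition block_system :: "('a \<Rightarrow> 'a) set \<Rightarrow> 'a set \<Rightarrow> 'a set set" where
  "block_system K B = (\<lambda>k. k ` B) ` K"

definition block_kernel :: "('a \<Rightarrow> 'a) set \<Rightarrow> 'a set set \<Rightarrow> ('a \<Rightarrow> 'a) set" where
  "block_kernel K P = {k \<in> K. \<forall>X\<in>P. k ` X = X}"

definition block_action :: "('a \<Rightarrow> 'a) set \<Rightarrow> 'a set set \<Rightarrow> ('a set \<Rightarrow> 'a set) set" where
  "block_action K P = (\<lambda>k. \<lambda>X\<in>P. k ` X) ` K"


section \<open>The principal section\<close>

definition minimal_block :: "('a, 'b) monoid_scheme \<Rightarrow> ('a \<Rightarrow> 'a) set \<Rightarrow> 'a set" where
  "minimal_block G K = \<Inter>{B. block (carrier G) K B \<and> \<one>\<^bsub>G\<^esub> \<in> B \<and> B \<noteq> {\<one>\<^bsub>G\<^esub>}}"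

definition minimal_system :: "('a, 'b) monoid_scheme \<Rightarrow> ('a \<Rightarrow> 'a) set \<Rightarrow> 'a set set" where
  "minimal_system G K = block_system K (minimal_block G K)"

definition linked_blocks ::
  "('a \<Rightarrow> 'a) set \<Rightarrow> 'a set set \<Rightarrow> 'a set \<Rightarrow> 'a set \<Rightarrow> bool" where
  "linked_blocks K P X X' \<longleftrightarrow>
     (\<forall>Y\<in>{X, X'}.
        (\<lambda>f. restrict f Y) \<in>
          iso (perm_group (X \<union> X') (induced_on (block_kernel K P) (X \<union> X')))
              (perm_group Y (induced_on (block_kernel K P) Y)))"

definition upper_block :: "('a, 'b) monoid_scheme \<Rightarrow> ('a \<Rightarrow> 'a) set \<Rightarrow> 'a set" where
  "upper_block G K =
     \<Union>{X \<in> minimal_system G K. linked_blocks K (minimal_system G K) (minimal_block G K) X}"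

definition upper_system :: "('a, 'b) monoid_scheme \<Rightarrow> ('a \<Rightarrow> 'a) set \<Rightarrow> 'a set set" where
  "upper_system G K = block_system K (upper_block G K)"

definition principal_section ::
  "('a, 'b) monoid_scheme \<Rightarrow> ('a \<Rightarrow> 'a) set \<Rightarrow>
     'a set \<Rightarrow> 'a set \<Rightarrow> 'a set set \<Rightarrow> 'a set set \<Rightarrow> bool" where
  "principal_section G K U L \<UU> \<LL> \<longleftrightarrow>
     L = minimal_block G K \<and> \<LL> = minimal_system G K \<and>
     U = upper_block G K \<and> \<UU> = upper_system G K"


section \<open>Groups of symmetric type\<close>

definition symplectic_form :: "nat \<Rightarrow> 'f :: field mat" where
  "symplectic_form m = four_block_mat (0\<^sub>m m m) (1\<^sub>m m) (- 1\<^sub>m m) (0\<^sub>m m m)"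

text \<open>\<open>symplectic_group TYPE('f) m\<close> is the group \<open>Sp\<close> of dimension \<open>2m\<close> over \<open>'f\<close>. The Gram matrix is
  alternating in every characteristic, so in characteristic 2 preserving it is preserving an
  alternating form.\<close>

definition symplectic_group :: "'f :: field itself \<Rightarrow> nat \<Rightarrow> 'f mat monoid" where
  "symplectic_group _ m =
     \<lparr>carrier = {A \<in> carrier_mat (2 * m) (2 * m).
                   transpose_mat A * symplectic_form m * A = symplectic_form m},
      monoid.mult = (*), one = 1\<^sub>m (2 * m)\<rparr>"

definition symmetric_type :: "('a, 'b) monoid_scheme \<Rightarrow> ('a \<Rightarrow> 'a) set \<Rightarrow> bool" where
  "symmetric_type G K \<longleftrightarrow>
     alternating (minimal_block G K) \<subseteq> induced_on K (minimal_block G K) \<or>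
     (G \<cong> sym_group 5 \<and>
      perm_group (carrier G) K \<cong> symplectic_group TYPE(bit) 4 \<and>
      two_transitive (carrier G) K)"

end

theory Submission
  imports Defs
begin

text \<open>The minimal block \<open>L\<close> is a normal subgroup containing the socle, hence has trivial centralizer, and
  the block kernel \<open>N\<close> contains all \<open>g \<mapsto> x g y\<close> with \<open>x, y \<in> L\<close>. Commutators of inner
  automorphisms of \<open>L\<close> with three-cycles show that \<open>N\<close> induces all three-cycles on every block. A counting
  argument shows that if the stabilizer in \<open>N\<close> of a point \<open>u\<close> is intransitive on another block \<open>Y\<close>, then it
  fixes some \<open>y \<in> Y\<close>; then \<open>y u\<^sup>-\<^sup>1\<close> centralizes \<open>L\<close>, which is impossible. So \<open>N\<close> is
  transitive on \<open>X \<times> Y\<close> for distinct blocks and 2-transitive on every block, and 2-closedness puts every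
  permutation fixing all blocks into \<open>K\<close>. A 2-closed 2-transitive \<open>K\<close> is the full symmetric group, so
  the exceptional case with \<open>Sp\<^sub>8(2)\<close> needs no information about that group.\<close>

section \<open>Permutation groups and their block systems\<close>

lemma Bij_iff: "f \<in> Bij S \<longleftrightarrow> f \<in> extensional S \<and> bij_betw f S S"
  by (auto simp: Bij_def)

locale permutation_group =
  fixes \<Omega> :: "'a set" and K :: "('a \<Rightarrow> 'a) set"
  assumes subgroup_K: "subgroup K (BijGroup \<Omega>)"
begin

lemma in_Bij: "k \<in> K \<Longrightarrow> k \<in> Bij \<Omega>"
  using subgroup.subset[OF subgroup_K] by (auto simp: BijGroup_def)

lemma bij: "k \<in> K \<Longrightarrow> bij_betw k \<Omega> \<Omega>"
  using in_Bij by (auto simp: Bij_iff)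

lemma extensional: "k \<in> K \<Longrightarrow> k \<in> extensional \<Omega>"
  using in_Bij by (auto simp: Bij_iff)

lemma inj: "k \<in> K \<Longrightarrow> inj_on k \<Omega>"
  using bij by (auto simp: bij_betw_def)

lemma inj_subset: "k \<in> K \<Longrightarrow> A \<subseteq> \<Omega> \<Longrightarrow> inj_on k A"
  using inj inj_on_subset by blast

lemma maps: "k \<in> K \<Longrightarrow> x \<in> \<Omega> \<Longrightarrow> k x \<in> \<Omega>"
  using bij by (auto simp: bij_betw_def)

lemma eq_iff: "k \<in> K \<Longrightarrow> x \<in> \<Omega> \<Longrightarrow> y \<in> \<Omega> \<Longrightarrow> k x = k y \<longleftrightarrow> x = y"
  using inj by (auto simp: inj_on_def)

lemma compose_closed: "k \<in> K \<Longrightarrow> l \<in> K \<Longrightarrow> compose \<Omega> k l \<in> K"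
  using subgroup.m_closed[OF subgroup_K, of k l] in_Bij by (simp add: BijGroup_def)

lemma id_closed: "(\<lambda>x\<in>\<Omega>. x) \<in> K"
  using subgroup.one_closed[OF subgroup_K] by (simp add: BijGroup_def)

lemma inv_closed: "k \<in> K \<Longrightarrow> restrict (inv_into \<Omega> k) \<Omega> \<in> K"
  using subgroup.m_inv_closed[OF subgroup_K, of k] in_Bij[of k] inv_BijGroup[of k \<Omega>] by simp

text \<open>Packages the inverse as an element of \<open>K\<close> with pointwise cancellation, so
  that conjugates can be computed point by point.\<close>

lemma inverse_ex:
  assumes "k \<in> K"
  obtains k' where "k' \<in> K" "\<forall>x\<in>\<Omega>. k' (k x) = x" "\<forall>x\<in>\<Omega>. k (k' x) = x"
proof -
  have "restrict (inv_into \<Omega> k) \<Omega> (k x) = x" if "x \<in> \<Omega>" for x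
    using that maps[OF assms] inj[OF assms] by simp
  moreover have "k (restrict (inv_into \<Omega> k) \<Omega> x) = x" if "x \<in> \<Omega>" for x
    using that bij[OF assms] by (simp add: bij_betw_inv_into_right)
  ultimately show thesis
    by (intro that[OF inv_closed[OF assms]] ballI)
qed

lemma compose_image: "A \<subseteq> \<Omega> \<Longrightarrow> compose \<Omega> k l ` A = k ` l ` A"
  by (force simp: compose_def)

end

lemma permutation_groupI:
  assumes "N \<subseteq> Bij \<Omega>" "(\<lambda>x\<in>\<Omega>. x) \<in> N" "\<And>k l. k \<in> N \<Longrightarrow> l \<in> N \<Longrightarrow> compose \<Omega> k l \<in> N"
    "\<And>k. k \<in> N \<Longrightarrow> restrict (inv_into \<Omega> k) \<Omega> \<in> N"
  shows "permutation_group \<Omega> N"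
proof (rule permutation_group.intro)
  show "subgroup N (BijGroup \<Omega>)"
  proof (rule subgroup.intro)
    show "N \<subseteq> carrier (BijGroup \<Omega>)"
      using assms(1) by (simp add: BijGroup_def)
    show "k \<otimes>\<^bsub>BijGroup \<Omega>\<^esub> l \<in> N" if "k \<in> N" "l \<in> N" for k l
      using that assms(1,3) by (auto simp: BijGroup_def subset_iff)
    show "\<one>\<^bsub>BijGroup \<Omega>\<^esub> \<in> N"
      using assms(2) by (simp add: BijGroup_def)
    show "inv\<^bsub>BijGroup \<Omega>\<^esub> k \<in> N" if "k \<in> N" for k
      using that assms(1,4) inv_BijGroup[of k \<Omega>] by auto
  qed
qed

section \<open>Three-cycles induced on a set\<close>

text \<open>Only the values on \<open>X\<close> are prescribed: an element of the kernel that cycles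
  three points of one block may act arbitrarily on the others.\<close>

definition three_cycle_on :: "'a set \<Rightarrow> ('a \<Rightarrow> 'a) \<Rightarrow> 'a \<Rightarrow> 'a \<Rightarrow> 'a \<Rightarrow> bool" where
  "three_cycle_on X k x y z \<longleftrightarrow> k x = y \<and> k y = z \<and> k z = x \<and> (\<forall>w\<in>X - {x, y, z}. k w = w)"

text \<open>For finite \<open>X\<close> and a group \<open>N\<close> fixing \<open>X\<close>
  setwise, this says that the group induced on \<open>X\<close> contains the alternating
  group.\<close>

definition has_three_cycles :: "('a \<Rightarrow> 'a) set \<Rightarrow> 'a set \<Rightarrow> bool" where
  "has_three_cycles N X \<longleftrightarrow>
     (\<forall>x\<in>X. \<forall>y\<in>X. \<forall>z\<in>X. x \<noteq> y \<and> y \<noteq> z \<and> x \<noteq> z \<longrightarrow> (\<exists>k\<in>N. three_cycle_on X k x y z))"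

lemma has_three_cyclesE:
  assumes "has_three_cycles N X" "x \<in> X" "y \<in> X" "z \<in> X" "x \<noteq> y" "y \<noteq> z" "x \<noteq> z"
  obtains k where "k \<in> N" "k x = y" "k y = z" "k z = x"
    "\<And>w. w \<in> X \<Longrightarrow> w \<noteq> x \<Longrightarrow> w \<noteq> y \<Longrightarrow> w \<noteq> z \<Longrightarrow> k w = w"
  using assms unfolding has_three_cycles_def three_cycle_on_def by blast

section \<open>The imprimitivity system of a block and its kernel\<close>

locale transitive_block = permutation_group +
  fixes B :: "'a set"
  assumes block_B: "block \<Omega> K B"
    and transitive: "\<And>x y. x \<in> \<Omega> \<Longrightarrow> y \<in> \<Omega> \<Longrightarrow> \<exists>k\<in>K. k x = y"
begin

abbreviation P where "P \<equiv> block_system K B"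
abbreviation N where "N \<equiv> block_kernel K P"

lemma B_subset: "B \<subseteq> \<Omega>" and B_nonempty: "B \<noteq> {}"
  using block_B by (auto simp: block_def)

lemma P_subset: "X \<in> P \<Longrightarrow> X \<subseteq> \<Omega>"
  using B_subset maps by (auto simp: block_system_def)

lemma P_nonempty: "X \<in> P \<Longrightarrow> X \<noteq> {}"
  using B_nonempty by (auto simp: block_system_def)

lemma P_image:
  assumes "k \<in> K" "X \<in> P"
  shows "k ` X \<in> P"
proof -
  obtain l where l: "l \<in> K" "X = l ` B"
    using assms by (auto simp: block_system_def)
  have "k ` X = compose \<Omega> k l ` B"
    unfolding l(2) by (rule compose_image[OF B_subset, symmetric])
  then show ?thesis
    unfolding block_system_def using compose_closed[OF assms(1) l(1)] by (rule image_eqI)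
qed

lemma B_in_P: "B \<in> P"
proof -
  have "(\<lambda>x\<in>\<Omega>. x) ` B = B"
    using B_subset by force
  then show ?thesis
    unfolding block_system_def using id_closed by (metis imageI)
qed

lemma P_image_back:
  assumes "X \<in> P"
  obtains k where "k \<in> K" "k ` X = B"
proof -
  obtain l where l: "l \<in> K" "X = l ` B"
    using assms by (auto simp: block_system_def)
  obtain l' where l': "l' \<in> K" "\<forall>x\<in>\<Omega>. l' (l x) = x" "\<forall>x\<in>\<Omega>. l (l' x) = x"
    by (rule inverse_ex[OF l(1)])
  have "l' (l b) = b" if "b \<in> B" for b
    by (rule bspec[OF l'(2) subsetD[OF B_subset that]])
  then have "l' ` X = B"
    unfolding l(2) image_image by simp
  then show ?thesis
    using l' that by blast
qed

text \<open>Moving \<open>X\<close> onto \<open>B\<close> by some \<open>k\<close> reduces the claim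
  to the block property of \<open>B\<close>, applied to an \<open>l\<close> with \<open>l\<close> B
  = k \<open>Y\<close>.\<close>

lemma P_disjoint:
  assumes "X \<in> P" "Y \<in> P" "x \<in> X" "x \<in> Y"
  shows "X = Y"
proof -
  obtain k where k: "k \<in> K" "k ` X = B"
    using assms P_image_back by blast
  obtain l where l: "l \<in> K" "l ` B = k ` Y"
    using P_image[OF k(1) assms(2)] by (auto simp: block_system_def)
  have "k x \<in> B" "k x \<in> l ` B"
    using assms(3,4) k l by auto
  then have "l ` B = B"
    using block_B l(1) unfolding block_def by blast
  then have "k ` X = k ` Y"
    using k l by simp
  then show ?thesis
    using inj_on_image_eq_iff[OF inj[OF k(1)]] P_subset assms by blast
qed

lemma P_cover:
  assumes "x \<in> \<Omega>"
  obtains X where "X \<in> P" "x \<in> X"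
proof -
  obtain b where b: "b \<in> B"
    using B_nonempty by blast
  then obtain k where "k \<in> K" "k b = x"
    using transitive[of b x] assms B_subset by blast
  then show ?thesis
    using that[of "k ` B"] b by (auto simp: block_system_def)
qed

lemma N_subset: "k \<in> N \<Longrightarrow> k \<in> K" and N_fixes: "k \<in> N \<Longrightarrow> X \<in> P \<Longrightarrow> k ` X = X"
  by (auto simp: block_kernel_def)

lemma N_I: "k \<in> K \<Longrightarrow> (\<And>X. X \<in> P \<Longrightarrow> k ` X = X) \<Longrightarrow> k \<in> N"
  by (auto simp: block_kernel_def)

lemma N_maps: "k \<in> N \<Longrightarrow> X \<in> P \<Longrightarrow> x \<in> X \<Longrightarrow> k x \<in> X"
  using N_fixes by blast

lemma inverse_image_eq:
  assumes "k \<in> K" "X \<subseteq> \<Omega>" "k ` X = Y"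
  shows "restrict (inv_into \<Omega> k) \<Omega> ` Y = X"
proof -
  have "restrict (inv_into \<Omega> k) \<Omega> (k x) = x" if "x \<in> X" for x
    using that assms maps[OF assms(1)] inj[OF assms(1)] by (simp add: subset_iff)
  then show ?thesis
    unfolding assms(3)[symmetric] image_image by force
qed

lemma N_group: "permutation_group \<Omega> N"
proof (rule permutation_groupI)
  show "N \<subseteq> Bij \<Omega>"
    using in_Bij by (auto simp: block_kernel_def)
  have "(\<lambda>x\<in>\<Omega>. x) ` X = X" if "X \<in> P" for X
    using P_subset[OF that] by force
  then show "(\<lambda>x\<in>\<Omega>. x) \<in> N"
    using id_closed by (auto simp: block_kernel_def)
  show "compose \<Omega> k l \<in> N" if "k \<in> N" "l \<in> N" for k l
  proof -
    have "compose \<Omega> k l ` X = X" if X: "X \<in> P" for X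
    proof -
      have "compose \<Omega> k l ` X = k ` l ` X"
        by (rule compose_image[OF P_subset[OF X]])
      also have "\<dots> = X"
        using X \<open>k \<in> N\<close> \<open>l \<in> N\<close> by (simp only: N_fixes)
      finally show ?thesis .
    qed
    then show ?thesis
      by (intro N_I[OF compose_closed[OF N_subset N_subset]] that)
  qed
  show "restrict (inv_into \<Omega> k) \<Omega> \<in> N" if "k \<in> N" for k
    using that by (intro N_I[OF inv_closed[OF N_subset]] inverse_image_eq[OF N_subset P_subset N_fixes])
qed

sublocale N: permutation_group \<Omega> N
  by (rule N_group)

text \<open>Normality of the kernel: \<open>m\<close> is the conjugate of \<open>n\<close> by
  \<open>k\<close>. It fixes a block \<open>X\<close> because \<open>n\<close> fixes the block which
  \<open>k\<close> maps to \<open>X\<close>.\<close>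

lemma N_normal:
  assumes "k \<in> K" "n \<in> N"
  obtains m where "m \<in> N" "\<And>x. x \<in> \<Omega> \<Longrightarrow> m (k x) = k (n x)"
proof -
  obtain k' where k': "k' \<in> K" "\<forall>x\<in>\<Omega>. k' (k x) = x" "\<forall>x\<in>\<Omega>. k (k' x) = x"
    by (rule inverse_ex[OF assms(1)])
  define m where "m = compose \<Omega> k (compose \<Omega> n k')"
  have "m \<in> K"
    unfolding m_def using assms k' N_subset compose_closed by simp
  moreover have "m ` X = X" if X: "X \<in> P" for X
  proof -
    have "m ` X = k ` compose \<Omega> n k' ` X"
      unfolding m_def by (rule compose_image[OF P_subset[OF X]])
    also have "\<dots> = k ` n ` k' ` X"
      by (simp only: compose_image[OF P_subset[OF X]])
    also have "\<dots> = k ` k' ` X"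
      using N_fixes[OF assms(2) P_image[OF k'(1) X]] by simp
    also have "\<dots> = X"
      using k'(3) P_subset[OF X] unfolding image_image by force
    finally show ?thesis .
  qed
  ultimately have "m \<in> N"
    by (simp add: block_kernel_def)
  moreover have "m (k x) = k (n x)" if "x \<in> \<Omega>" for x
    unfolding m_def using that k' maps[OF assms(1)] by (simp add: compose_def)
  ultimately show ?thesis
    using that by blast
qed

text \<open>Conjugation by \<open>h\<close> relabels the points of a cycle, and normality keeps the
  conjugate in the kernel even though \<open>h\<close> is only in \<open>K\<close>.\<close>

lemma three_cycle_transport:
  assumes "h \<in> K" "X \<subseteq> \<Omega>" "h ` X = Y" "k \<in> N" "three_cycle_on X k x y z"
    "x \<in> X" "y \<in> X" "z \<in> X"
  obtains m where "m \<in> N" "three_cycle_on Y m (h x) (h y) (h z)"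
proof -
  obtain m where m: "m \<in> N" "\<And>x. x \<in> \<Omega> \<Longrightarrow> m (h x) = h (k x)"
    using N_normal[OF assms(1,4)] by blast
  have k: "k x = y" "k y = z" "k z = x" "\<And>w. w \<in> X - {x, y, z} \<Longrightarrow> k w = w"
    using assms(5) unfolding three_cycle_on_def by blast+
  have "m (h w) = h w" if "w \<in> X" "h w \<notin> {h x, h y, h z}" for w
  proof -
    have "k w = w"
      using that by (intro k(4)) auto
    then show ?thesis
      using m(2)[of w] that(1) assms(2) by auto
  qed
  then have "\<forall>w\<in>Y - {h x, h y, h z}. m w = w"
    using assms(3) by blast
  moreover have "m (h x) = h y" "m (h y) = h z" "m (h z) = h x"
    using m(2) k(1-3) assms(2,6-8) by auto
  ultimately have "three_cycle_on Y m (h x) (h y) (h z)"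
    unfolding three_cycle_on_def by blast
  then show ?thesis
    using m that by blast
qed

lemma has_three_cycles_transport:
  assumes "has_three_cycles N B" "X \<in> P"
  shows "has_three_cycles N X"
proof -
  obtain h where h: "h \<in> K" "h ` B = X"
    using assms(2) by (auto simp: block_system_def)
  show ?thesis
    unfolding has_three_cycles_def
  proof (intro ballI impI)
    fix x y z
    assume "x \<in> X" "y \<in> X" "z \<in> X" and ne: "x \<noteq> y \<and> y \<noteq> z \<and> x \<noteq> z"
    then obtain a b c where abc: "a \<in> B" "b \<in> B" "c \<in> B" "h a = x" "h b = y" "h c = z"
      using h by blast
    then obtain k where "k \<in> N" "three_cycle_on B k a b c"
      using ne assms(1) unfolding has_three_cycles_def by metis
    then show "\<exists>k\<in>N. three_cycle_on X k x y z"
      using three_cycle_transport[OF h(1) B_subset h(2), of k a b c] abc by metis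
  qed
qed

end

section \<open>Two-closure and three-cycles on blocks\<close>

text \<open>Different exchanges of an element \<open>z\<close> of \<open>S\<close> for an element
  \<open>r\<close> outside \<open>S\<close> give different sets. The set \<open>S\<close> itself is
  none of them, which accounts for the summand 1.\<close>

lemma card_exchange_family:
  assumes "finite Y" "S \<subseteq> Y" "finite F" "S \<in> F"
    and exchange: "\<And>z r. z \<in> S \<Longrightarrow> r \<in> Y - S \<Longrightarrow> insert r (S - {z}) \<in> F"
  shows "card S * card (Y - S) + 1 \<le> card F"
proof -
  let ?f = "\<lambda>(z, r). insert r (S - {z})"
  have "inj_on ?f (S \<times> (Y - S))"
  proof (rule inj_onI, clarify)
    fix z r z' r'
    assume *: "z \<in> S" "r \<in> Y" "r \<notin> S" "z' \<in> S" "r' \<in> Y" "r' \<notin> S"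
      "insert r (S - {z}) = insert r' (S - {z'})"
    have "r = r'"
      using * by blast
    moreover have "S - {z} = S - {z'}"
      using * \<open>r = r'\<close> insert_ident[of r "S - {z}" "S - {z'}"] by blast
    then have "z = z'"
      using * by blast
    ultimately show "z = z' \<and> r = r'"
      by blast
  qed
  then have "card (?f ` (S \<times> (Y - S))) = card S * card (Y - S)"
    by (simp add: card_image card_cartesian_product)
  moreover have "S \<notin> ?f ` (S \<times> (Y - S))" "insert S (?f ` (S \<times> (Y - S))) \<subseteq> F"
    using exchange assms(4) by auto
  ultimately show ?thesis
    using card_mono[OF assms(3), of "insert S (?f ` (S \<times> (Y - S)))"] assms(1,2)
    by (simp add: finite_subset card_insert_if)
qed

lemma exists_outside:
  assumes "finite X" "card S < card X" "finite S"
  obtains w where "w \<in> X" "w \<notin> S"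
  using assms by (meson card_mono linorder_not_le subsetI)

section \<open>Two-closedness tested on pairs of points\<close>

context permutation_group
begin

text \<open>Agreeing on each pair of points with some element of \<open>K\<close> makes \<sigma> map
  every orbit on pairs into itself. Orbits are finite and \<sigma> is injective, so they are mapped
  onto themselves.\<close>

lemma two_closed_memI:
  assumes "finite \<Omega>" "two_closed \<Omega> K" "\<sigma> \<in> Bij \<Omega>"
    and pairs: "\<And>u v. u \<in> \<Omega> \<Longrightarrow> v \<in> \<Omega> \<Longrightarrow> \<exists>k\<in>K. k u = \<sigma> u \<and> k v = \<sigma> v"
  shows "\<sigma> \<in> K"
proof -
  have "map_prod \<sigma> \<sigma> ` S = S" if S: "S \<in> orbits (perm_group \<Omega> K) (\<Omega> \<times> \<Omega>) (\<lambda>k. map_prod k k)" for S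
  proof -
    obtain a b where ab: "a \<in> \<Omega>" "b \<in> \<Omega>" "S = (\<lambda>k. (k a, k b)) ` K"
      using S by (force simp: orbits_def orbit_def perm_group_def)
    have "S \<subseteq> \<Omega> \<times> \<Omega>"
      using ab maps by auto
    then have "finite S"
      using assms(1) finite_subset by blast
    moreover have "map_prod \<sigma> \<sigma> ` S \<subseteq> S"
    proof
      fix p assume "p \<in> map_prod \<sigma> \<sigma> ` S"
      then obtain k where k: "k \<in> K" "p = (\<sigma> (k a), \<sigma> (k b))"
        using ab(3) by auto
      then obtain l where l: "l \<in> K" "l (k a) = \<sigma> (k a)" "l (k b) = \<sigma> (k b)"
        using pairs maps ab by blast
      have "p = (compose \<Omega> l k a, compose \<Omega> l k b)"
        using k l ab by (simp add: compose_def)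
      then show "p \<in> S"
        using compose_closed[OF l(1) k(1)] ab(3) by blast
    qed
    moreover have "inj_on (map_prod \<sigma> \<sigma>) S"
      using assms(3) by (intro inj_on_subset[OF map_prod_inj_on \<open>S \<subseteq> \<Omega> \<times> \<Omega>\<close>]) (auto simp: Bij_def bij_betw_def)
    ultimately show ?thesis
      by (simp add: endo_inj_surj)
  qed
  then show ?thesis
    using assms(2,3) by (simp add: two_closed_def)
qed

end

section \<open>Transitivity of the kernel on pairs of points\<close>

context transitive_block
begin

lemma card_P:
  assumes "X \<in> P"
  shows "card X = card B"
proof -
  obtain h where h: "h \<in> K" "h ` B = X"
    using assms by (auto simp: block_system_def)
  then show ?thesis
    using card_image[OF inj_subset[OF h(1) B_subset]] by simp
qed

text \<open>With a fourth point \<open>w\<close>, the three-cycle sending \<open>v\<close> to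
  \<open>v'\<close> to \<open>w\<close> avoids \<open>u\<close>. This is where blocks must have at
  least four points.\<close>

lemma three_cycles_fix_move:
  assumes "has_three_cycles N X" "X \<in> P" "finite X" "card X \<ge> 4" "u \<in> X" "v \<in> X" "v' \<in> X" "u \<noteq> v" "u \<noteq> v'"
  obtains k where "k \<in> N" "k u = u" "k v = v'"
proof (cases "v = v'")
  case True
  then show ?thesis
    using that[OF N.id_closed] subsetD[OF P_subset[OF assms(2)]] assms(5-7) by simp
next
  case False
  obtain w where w: "w \<in> X" "w \<notin> {u, v, v'}"
    using exists_outside[of X "{u, v, v'}"] assms(3,4,8,9) False by auto
  obtain k where "k \<in> N" "k v = v'" "k v' = w" "k w = v"
    "\<And>x. x \<in> X \<Longrightarrow> x \<noteq> v \<Longrightarrow> x \<noteq> v' \<Longrightarrow> x \<noteq> w \<Longrightarrow> k x = x"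
    using has_three_cyclesE[OF assms(1), of v v' w] assms w False by auto
  then show ?thesis
    using that[of k] assms w by auto
qed

lemma three_cycles_move:
  assumes "has_three_cycles N X" "X \<in> P" "finite X" "card X \<ge> 4" "u \<in> X" "u' \<in> X"
  obtains k where "k \<in> N" "k u = u'"
proof -
  have "card {u, u'} < card X"
    using card_insert_le_m1[of 2 "{u'}" u] assms(4) by simp
  \<comment> \<open>Any point other than \<open>u\<close> and \<open>u'\<close> can play the role of
    the point held fixed.\<close>
  then obtain w where "w \<in> X" "w \<notin> {u, u'}"
    using exists_outside[OF assms(3)] by auto
  then show ?thesis
    using three_cycles_fix_move[OF assms(1-4), of w u u'] assms(5,6) that by auto
qed

text \<open>First \<open>u\<close> is moved to \<open>u'\<close>, then the image of \<open>v\<close>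
  is corrected by an element fixing \<open>u'\<close>.\<close>

lemma three_cycles_two_transitive:
  assumes "has_three_cycles N X" "X \<in> P" "finite X" "card X \<ge> 4"
    "u \<in> X" "v \<in> X" "u' \<in> X" "v' \<in> X" "u \<noteq> v" "u' \<noteq> v'"
  obtains k where "k \<in> N" "k u = u'" "k v = v'"
proof -
  obtain k where k: "k \<in> N" "k u = u'"
    using three_cycles_move[OF assms(1-4)] assms(5,7) by blast
  have X: "X \<subseteq> \<Omega>"
    using P_subset assms(2) .
  have "k v \<in> X" "u' \<noteq> k v"
    using k N_maps[OF k(1) assms(2,6)] N.eq_iff[OF k(1), of u v] assms X by auto
  then obtain l where l: "l \<in> N" "l u' = u'" "l (k v) = v'"
    using three_cycles_fix_move[OF assms(1-4), of u' "k v" v'] assms by blast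
  show ?thesis
    using that[OF N.compose_closed[OF l(1) k(1)]] k l subsetD[OF X assms(5)] subsetD[OF X assms(6)] by (simp add: compose_eq)
qed

text \<open>An orbit \<open>S\<close> in \<open>Y\<close> of the stabilizer of \<open>u\<close> has at most \<open>card X\<close> images under \<open>N\<close>, but
  three-cycles on \<open>Y\<close> move it to \<open>S\<close> with any one element exchanged. If \<open>S\<close> is proper, then \<open>S\<close> or its
  complement is a singleton, that is, a fixed point of the stabilizer.\<close>

lemma stabilizer_transitive:
  assumes fin: "finite \<Omega>" and tc: "has_three_cycles N Y"
    and XY: "X \<in> P" "Y \<in> P" and u: "u \<in> X"
    and no_fixed: "\<And>y. y \<in> Y \<Longrightarrow> \<exists>k\<in>N. k u = u \<and> k y \<noteq> y"
    and v: "v \<in> Y" "v' \<in> Y"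
  obtains k where "k \<in> N" "k u = u" "k v = v'"
proof -
  define S where "S = {k v | k. k \<in> N \<and> k u = u}"
  define F where "F = (\<lambda>k. k ` S) ` N"
  have sub: "X \<subseteq> \<Omega>" "Y \<subseteq> \<Omega>"
    using P_subset XY by auto
  then have finXY: "finite X" "finite Y"
    using fin finite_subset by auto
  have SY: "S \<subseteq> Y"
    using N_maps XY(2) v(1) by (auto simp: S_def)
  have vS: "v \<in> S"
    unfolding S_def using N.id_closed sub u v(1)
    by (intro CollectI exI[of _ "\<lambda>x\<in>\<Omega>. x"]) auto
  have S_closed: "k s \<in> S" if "k \<in> N" "k u = u" and s: "s \<in> S" for k s
  proof -
    obtain l where l: "l \<in> N" "l u = u" "s = l v"
      using s unfolding S_def by blast
    have "compose \<Omega> k l \<in> N" "compose \<Omega> k l u = u" "compose \<Omega> k l v = k s"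
      using N.compose_closed[OF that(1) l(1)] that l sub u v(1) by (auto simp: compose_def)
    then show ?thesis
      unfolding S_def by (intro CollectI exI[of _ "compose \<Omega> k l"]) simp
  qed
  have S_stable: "k ` S = S" if "k \<in> N" "k u = u" for k
    using finite_subset[OF SY finXY(2)] S_closed[OF that] N.inj_subset[OF that(1)] SY sub
    by (intro endo_inj_surj) auto
  have S_fixed_compl: "k ` (Y - S) = Y - S" if "k \<in> N" "k u = u" for k
  proof -
    have "Y - S \<subseteq> \<Omega>" "S \<subseteq> \<Omega>"
      using SY sub by auto
    then show ?thesis
      using inj_on_image_set_diff[OF N.inj[OF that(1)]] S_stable[OF that] N_fixes[OF that(1) XY(2)] by simp
  qed
  have "S = Y"
  proof (rule ccontr)
    assume "S \<noteq> Y"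
    have F_sub: "F \<subseteq> (\<lambda>x. (SOME k. k \<in> N \<and> k u = x) ` S) ` X"
    proof
      fix A assume "A \<in> F"
      then obtain k where k: "k \<in> N" "A = k ` S"
        by (auto simp: F_def)
      define l where "l = (SOME l. l \<in> N \<and> l u = k u)"
      have l: "l \<in> N" "l u = k u"
        using someI[of "\<lambda>l. l \<in> N \<and> l u = k u" k] k by (auto simp: l_def)
      obtain k' where k': "k' \<in> N" "\<forall>x\<in>\<Omega>. k' (k x) = x" "\<forall>x\<in>\<Omega>. k (k' x) = x"
        by (rule N.inverse_ex[OF k(1)])
      have "compose \<Omega> k' l ` S = S"
        using N.compose_closed[OF k'(1) l(1)] k' l u sub by (intro S_stable) (auto simp: compose_def)
      then have eq: "k' ` l ` S = S"
        using N.compose_image[of S k' l] SY sub by auto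
      have "l ` S \<subseteq> \<Omega>"
        using SY sub N.maps[OF l(1)] by auto
      then have "l ` S = k ` k' ` l ` S"
        using k'(3) by (force simp: image_image)
      then have "A = l ` S"
        unfolding eq k(2) by simp
      then show "A \<in> (\<lambda>x. (SOME k. k \<in> N \<and> k u = x) ` S) ` X"
        unfolding l_def using N_maps[OF k(1) XY(1) u] by (rule image_eqI)
    qed
    have finF: "finite F" and cardF: "card F \<le> card X"
      using finite_surj[OF finXY(1) F_sub] surj_card_le[OF finXY(1) F_sub] .
    \<comment> \<open>A stable one-point set would be a fixed point of the stabilizer of
      \<open>u\<close>, against \<open>no_fixed\<close>. This is applied to \<open>S\<close> and to
      its complement.\<close>
    have singleton: False if "y \<in> Y" "A = {y}" "\<And>k. k \<in> N \<Longrightarrow> k u = u \<Longrightarrow> k ` A = A" for A y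
      using no_fixed[OF that(1)] that(2,3) by auto
    have "card S \<noteq> 0" "card (Y - S) \<noteq> 0"
      using \<open>S \<noteq> Y\<close> SY vS finXY(2) finite_subset[OF SY finXY(2)] by (auto simp: card_eq_0_iff)
    moreover have "card S \<noteq> 1"
      using singleton[of _ S] S_stable SY by (auto simp: card_1_singleton_iff)
    moreover have "card (Y - S) \<noteq> 1"
    proof
      assume "card (Y - S) = 1"
      then obtain y where y: "Y - S = {y}"
        by (auto simp: card_1_singleton_iff)
      then show False
        using singleton[OF _ y] S_fixed_compl by blast
    qed
    ultimately have ge2: "card S \<ge> 2" "card (Y - S) \<ge> 2"
      by linarith+
    have "(\<lambda>x\<in>\<Omega>. x) ` S = S"
      using SY sub by force
    then have "S \<in> F"
      unfolding F_def using N.id_closed by (metis imageI)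
    moreover have "insert r (S - {z}) \<in> F" if z: "z \<in> S" and r: "r \<in> Y - S" for z r
    proof -
      \<comment> \<open>A second point \<open>p\<close> of \<open>S\<close> is needed for the cycle
        \<open>p\<close> to \<open>r\<close> to \<open>z\<close> to \<open>p\<close>: it sends
        \<open>p\<close> out of \<open>S\<close> to \<open>r\<close>, while \<open>z\<close> takes
        the place of \<open>p\<close>, so exactly \<open>z\<close> is lost and \<open>r\<close>
        gained.\<close>
      obtain p where p: "p \<in> S" "p \<noteq> z"
        using ge2(1) exists_outside[of S "{z}"] finite_subset[OF SY finXY(2)] by auto
      obtain k where k: "k \<in> N" "k p = r" "k r = z" "k z = p"
        "\<And>x. x \<in> Y \<Longrightarrow> x \<noteq> p \<Longrightarrow> x \<noteq> r \<Longrightarrow> x \<noteq> z \<Longrightarrow> k x = x"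
        using has_three_cyclesE[OF tc, of p r z] p z r SY by blast
      have fixed: "k x = x" if "x \<in> S - {p, z}" for x
        using k(5)[of x] that r SY by auto
      have "S = insert p (insert z (S - {p, z}))"
        using p z by auto
      then have "k ` S = insert (k p) (insert (k z) (k ` (S - {p, z})))"
        by (metis image_insert)
      also have "k ` (S - {p, z}) = S - {p, z}"
        using fixed by force
      finally have "k ` S = insert r (S - {z})"
        using k p z by auto
      then show ?thesis
        unfolding F_def using k(1) by (metis imageI)
    qed
    ultimately have "card S * card (Y - S) + 1 \<le> card F"
      using card_exchange_family[OF finXY(2) SY finF] by blast
    \<comment> \<open>All blocks have the same size, so \<open>card X\<close> equals
      \<open>card Y\<close>, which splits into the two summands.\<close>
    also have "\<dots> \<le> card S + card (Y - S)"
      using cardF card_P[OF XY(1)] card_P[OF XY(2)] card_Diff_subset[OF finite_subset[OF SY finXY(2)] SY]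
        card_mono[OF finXY(2) SY] by simp
    finally have le: "card S * card (Y - S) + 1 \<le> card S + card (Y - S)" .
    \<comment> \<open>For two numbers that are at least 2 the product is at least the sum, so adding
      1 gives a contradiction.\<close>
    obtain a b where "card S = a + 2" "card (Y - S) = b + 2"
      using ge2 by (metis add.commute le_Suc_ex)
    with le show False
      by simp
  qed
  then obtain k where "k \<in> N" "k u = u" "k v = v'"
    using v(2) by (auto simp: S_def)
  then show ?thesis
    using that by blast
qed

text \<open>It suffices to match \<sigma> at two points \<open>u\<close>, \<open>v\<close> by an
  element of \<open>N\<close>. Within one block, 2-transitivity does this. For different blocks,
  \<open>u\<close> is first moved to \<open>\<sigma> u\<close>, and then the stabilizer of
  \<open>\<sigma> u\<close>, transitive on the block of \<open>v\<close>, corrects the second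
  value.\<close>

lemma block_fixing_mem_if_two_closed:
  assumes fin: "finite \<Omega>" and closed: "two_closed \<Omega> K" and tc: "has_three_cycles N B" and "card B \<ge> 4"
    and no_fixed: "\<And>X Y u y. X \<in> P \<Longrightarrow> Y \<in> P \<Longrightarrow> X \<noteq> Y \<Longrightarrow> u \<in> X \<Longrightarrow> y \<in> Y \<Longrightarrow> \<exists>k\<in>N. k u = u \<and> k y \<noteq> y"
    and \<sigma>: "\<sigma> \<in> Bij \<Omega>" "\<And>X. X \<in> P \<Longrightarrow> \<sigma> ` X = X"
  shows "\<sigma> \<in> N"
proof -
  have finP: "finite X" and cardP: "card X \<ge> 4" and tcP: "has_three_cycles N X" if "X \<in> P" for X
    using finite_subset[OF P_subset[OF that] fin] card_P[OF that] assms(4)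
      has_three_cycles_transport[OF tc that] by auto
  have "\<exists>k\<in>K. k u = \<sigma> u \<and> k v = \<sigma> v" if uv: "u \<in> \<Omega>" "v \<in> \<Omega>" for u v
  proof -
    obtain X where "X \<in> P" "u \<in> X"
      by (rule P_cover[OF uv(1)])
    moreover obtain Y where "Y \<in> P" "v \<in> Y"
      by (rule P_cover[OF uv(2)])
    ultimately have XY: "X \<in> P" "u \<in> X" "Y \<in> P" "v \<in> Y" .
    then have img: "\<sigma> u \<in> X" "\<sigma> v \<in> Y"
      using \<sigma>(2) by blast+
    obtain k where k: "k \<in> N" "k u = \<sigma> u"
      using three_cycles_move[OF tcP[OF XY(1)] XY(1) finP[OF XY(1)] cardP[OF XY(1)]] XY(1,2) img(1) by blast
    consider "u = v" | "u \<noteq> v" "X = Y" | "X \<noteq> Y"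
      by blast
    then have "\<exists>k\<in>N. k u = \<sigma> u \<and> k v = \<sigma> v"
    proof cases
      case 1
      then show ?thesis
        using k by blast
    next
      case 2
      then have "\<sigma> u \<noteq> \<sigma> v"
        using \<sigma>(1) uv by (auto simp: Bij_def bij_betw_def inj_on_def)
      then show ?thesis
        using three_cycles_two_transitive[OF tcP[OF XY(1)] XY(1) finP[OF XY(1)] cardP[OF XY(1)]] XY img 2 by blast
    next
      case 3
      have "k v \<in> Y"
        using N_maps k(1) XY by blast
      then obtain l where l: "l \<in> N" "l (\<sigma> u) = \<sigma> u" "l (k v) = \<sigma> v"
        using stabilizer_transitive[OF fin tcP[OF XY(3)] XY(1,3) img(1) no_fixed[OF XY(1,3) 3 img(1)]] img(2)
        by blast
      have "compose \<Omega> l k u = \<sigma> u" "compose \<Omega> l k v = \<sigma> v"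
        using k l uv by (auto simp: compose_def)
      then show ?thesis
        using N.compose_closed[OF l(1) k(1)] by blast
    qed
    then show ?thesis
      using N_subset by blast
  qed
  then have "\<sigma> \<in> K"
    using two_closed_memI[OF fin closed \<sigma>(1)] by blast
  then show ?thesis
    using \<sigma>(2) by (rule N_I)
qed

end

section \<open>Kernels containing all block-fixing permutations\<close>

text \<open>Transport of structure along \<open>g\<close>. Since the transported group is explicit,
  identifying \<open>K\<close> with a wreath product becomes an equality of sets of
  permutations.\<close>

lemma perm_isomorphic_conjugate:
  assumes "permutation_group \<Omega> K" and g: "bij_betw g \<Delta> \<Omega>"
  shows "perm_isomorphic \<Omega> K \<Delta> ((\<lambda>k. \<lambda>p\<in>\<Delta>. inv_into \<Delta> g (k (g p))) ` K)"
proof -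
  interpret permutation_group \<Omega> K
    by fact
  define f where "f = inv_into \<Delta> g"
  define \<phi> where "\<phi> k = (\<lambda>p\<in>\<Delta>. f (k (g p)))" for k
  have f: "bij_betw f \<Omega> \<Delta>"
    unfolding f_def using g by (rule bij_betw_inv_into)
  have fg: "f (g p) = p" if "p \<in> \<Delta>" for p
    using that g by (simp add: f_def bij_betw_inv_into_left)
  have gf: "g (f x) = x" if "x \<in> \<Omega>" for x
    using that g by (simp add: f_def bij_betw_inv_into_right)
  have g_in: "g p \<in> \<Omega>" if "p \<in> \<Delta>" for p
    using that g by (rule bij_betw_apply[rotated])
  have f_in: "f x \<in> \<Delta>" if "x \<in> \<Omega>" for x
    using that f by (rule bij_betw_apply[rotated])
  have \<phi>_Bij: "\<phi> k \<in> Bij \<Delta>" if "k \<in> K" for k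
  proof -
    have "bij_betw (f \<circ> k \<circ> g) \<Delta> \<Delta>"
      using g bij[OF that] f by (intro bij_betw_trans)
    then have "bij_betw (\<phi> k) \<Delta> \<Delta>"
      by (rule bij_betw_cong[THEN iffD1, rotated]) (simp add: \<phi>_def)
    then show ?thesis
      by (simp add: Bij_iff \<phi>_def)
  qed
  have \<phi>_compose: "\<phi> (compose \<Omega> k l) = compose \<Delta> (\<phi> k) (\<phi> l)" if "k \<in> K" "l \<in> K" for k l
    using maps[OF that(2)] maps[OF that(1)] by (auto simp: \<phi>_def compose_def g_in f_in gf fun_eq_iff)
  have "\<phi> \<in> hom (perm_group \<Omega> K) (perm_group \<Delta> (\<phi> ` K))"
    by (rule homI) (auto simp: perm_group_def BijGroup_def in_Bij \<phi>_Bij \<phi>_compose)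
  moreover have "inj_on \<phi> K"
  proof (rule inj_onI)
    fix k l assume kl: "k \<in> K" "l \<in> K" "\<phi> k = \<phi> l"
    show "k = l"
    proof (rule extensionalityI[OF extensional[OF kl(1)] extensional[OF kl(2)]])
      fix x assume x: "x \<in> \<Omega>"
      have "\<phi> k (f x) = \<phi> l (f x)"
        using kl(3) by simp
      then have "f (k x) = f (l x)"
        using x by (simp add: \<phi>_def f_in gf)
      then show "k x = l x"
        using gf maps kl x by metis
    qed
  qed
  then have "bij_betw \<phi> K (\<phi> ` K)"
    by (rule inj_on_imp_bij_betw)
  ultimately have "\<phi> \<in> iso (perm_group \<Omega> K) (perm_group \<Delta> (\<phi> ` K))"
    by (simp add: iso_def perm_group_def)
  moreover have "f (k x) = \<phi> k (f x)" if "x \<in> \<Omega>" for k x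
    using that by (simp add: \<phi>_def f_in gf)
  ultimately have "perm_isomorphic \<Omega> K \<Delta> (\<phi> ` K)"
    unfolding perm_isomorphic_def using f by blast
  then show ?thesis
    by (simp add: \<phi>_def[abs_def] f_def)
qed

lemma restrict_Bij_extend:
  assumes "X \<subseteq> \<Omega>" "\<sigma> \<in> Bij X"
  shows "(\<lambda>x\<in>\<Omega>. if x \<in> X then \<sigma> x else x) \<in> Bij \<Omega>" (is "?e \<in> _")
    and "(\<lambda>x\<in>\<Omega>. if x \<in> X then \<sigma> x else x) ` X = X"
proof -
  have "bij_betw ?e X X"
    using assms by (subst bij_betw_cong[of _ _ \<sigma>]) (auto simp: Bij_iff)
  moreover have "bij_betw ?e (\<Omega> - X) (\<Omega> - X)"
    by (subst bij_betw_cong[of _ _ id]) auto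
  ultimately have "bij_betw ?e (X \<union> (\<Omega> - X)) (X \<union> (\<Omega> - X))"
    by (rule bij_betw_combine) auto
  then show "?e \<in> Bij \<Omega>"
    using assms(1) by (simp add: Bij_iff Un_absorb1)
  show "?e ` X = X"
    using \<open>bij_betw ?e X X\<close> by (simp add: bij_betw_def)
qed

lemma restrict_image_Bij:
  assumes "inj_on k X" "k ` X = X"
  shows "restrict k X \<in> Bij X"
  using assms by (auto simp: Bij_iff bij_betw_def)

section \<open>Wreath decomposition and linked blocks under a full kernel\<close>

context transitive_block
begin

lemma block_fixing_Bij:
  assumes "\<And>X. X \<in> P \<Longrightarrow> bij_betw \<rho> X X" "\<rho> \<in> extensional \<Omega>"
  shows "\<rho> \<in> Bij \<Omega>"
proof -
  have \<Omega>: "\<Omega> = \<Union>P"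
    using P_subset P_cover by blast
  have "inj_on \<rho> \<Omega>"
  proof (rule inj_onI)
    fix x y assume xy: "x \<in> \<Omega>" "y \<in> \<Omega>" "\<rho> x = \<rho> y"
    obtain X where X: "X \<in> P" "x \<in> X"
      by (rule P_cover[OF xy(1)])
    obtain Y where Y: "Y \<in> P" "y \<in> Y"
      by (rule P_cover[OF xy(2)])
    have "\<rho> x \<in> X" "\<rho> y \<in> Y"
      using bij_betw_apply[OF assms(1)] X Y by blast+
    then have "X = Y"
      using P_disjoint X(1) Y(1) xy(3) by metis
    then show "x = y"
      using assms(1)[OF X(1)] X Y xy(3) by (auto simp: bij_betw_def inj_on_def)
  qed
  moreover have "\<rho> ` \<Omega> = \<Omega>"
    unfolding \<Omega> image_Union using assms(1) by (auto simp: bij_betw_def)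
  ultimately show ?thesis
    using assms(2) by (simp add: Bij_iff bij_betw_def)
qed

text \<open>Choosing for each block \<open>X\<close> an element \<open>c X\<close> of
  \<open>K\<close> that carries \<open>B\<close> onto \<open>X\<close> gives every point coordinates
  in \<open>B \<times> P\<close>. Each \<open>k\<close> then permutes the blocks and acts on the
  first coordinate by a family in \<open>Bij B\<close>. Conversely, any family is realized over a
  given block permutation, since the necessary correction fixes all blocks and lies in
  \<open>N\<close> by \<open>full\<close>.\<close>

lemma perm_isomorphic_imprimitive_wreath:
  assumes full: "\<And>\<sigma>. \<sigma> \<in> Bij \<Omega> \<Longrightarrow> (\<And>X. X \<in> P \<Longrightarrow> \<sigma> ` X = X) \<Longrightarrow> \<sigma> \<in> N"
  shows "perm_isomorphic \<Omega> K (B \<times> P) (imprimitive_wreath B (Bij B) P (block_action K P))"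
proof -
  have "\<exists>k. k \<in> K \<and> k ` B = X" if "X \<in> P" for X
    using that by (auto simp: block_system_def)
  then obtain c where c: "\<And>X. X \<in> P \<Longrightarrow> c X \<in> K" "\<And>X. X \<in> P \<Longrightarrow> c X ` B = X"
    by metis
  have c_bij: "bij_betw (c X) B X" if "X \<in> P" for X
    using inj_subset[OF c(1)[OF that] B_subset] c(2)[OF that] by (simp add: bij_betw_def)
  define g where "g = (\<lambda>(\<delta>, X). c X \<delta>)"
  define f where "f = inv_into (B \<times> P) g"
  have g: "bij_betw g (B \<times> P) \<Omega>"
    unfolding bij_betw_def
  proof
    show "inj_on g (B \<times> P)"
    proof (rule inj_onI, clarsimp simp: g_def)
      fix \<delta> X \<epsilon> Y
      assume *: "\<delta> \<in> B" "X \<in> P" "\<epsilon> \<in> B" "Y \<in> P" "c X \<delta> = c Y \<epsilon>"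
      have "c X \<delta> \<in> X" "c Y \<epsilon> \<in> Y"
        using bij_betw_apply[OF c_bij] *(1-4) by blast+
      then have "X = Y"
        using P_disjoint *(2,4,5) by metis
      then show "\<delta> = \<epsilon> \<and> X = Y"
        using * c_bij[of X] by (auto simp: bij_betw_def inj_on_def)
    qed
    have "g ` (B \<times> P) = (\<Union>X\<in>P. c X ` B)"
      by (force simp: g_def)
    also have "\<dots> = \<Union>P"
      using c(2) by simp
    also have "\<dots> = \<Omega>"
      using P_subset P_cover by blast
    finally show "g ` (B \<times> P) = \<Omega>" .
  qed
  have fc: "f (c X \<delta>) = (\<delta>, X)" if "X \<in> P" "\<delta> \<in> B" for X \<delta>
    using bij_betw_inv_into_left[OF g, of "(\<delta>, X)"] that by (simp add: f_def g_def)
  have f_eq: "f y = (inv_into B (c Y) y, Y)" if "Y \<in> P" "y \<in> Y" for y Y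
  proof -
    have "c Y (inv_into B (c Y) y) = y" "inv_into B (c Y) y \<in> B"
      using c(2)[OF that(1)] that(2) by (auto intro: f_inv_into_f inv_into_into)
    then show ?thesis
      using fc[OF that(1), of "inv_into B (c Y) y"] by simp
  qed
  have "(\<lambda>k. \<lambda>p\<in>B \<times> P. f (k (g p))) ` K = imprimitive_wreath B (Bij B) P (block_action K P)"
    (is "?\<phi> ` K = ?W")
  proof (intro equalityI subsetI)
    fix w assume "w \<in> ?\<phi> ` K"
    then obtain k where k: "k \<in> K" "w = ?\<phi> k"
      by blast
    define h where "h X = (\<lambda>\<delta>\<in>B. inv_into B (c (k ` X)) (k (c X \<delta>)))" for X
    have "h X \<in> Bij B" if X: "X \<in> P" for X
    proof -
      have "bij_betw k X (k ` X)"
        using inj_subset[OF k(1) P_subset[OF X]] by (simp add: bij_betw_def)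
      then have "bij_betw (inv_into B (c (k ` X)) \<circ> k \<circ> c X) B B"
        using c_bij[OF X] bij_betw_inv_into[OF c_bij[OF P_image[OF k(1) X]]]
        by (intro bij_betw_trans)
      then have "bij_betw (h X) B B"
        by (rule bij_betw_cong[THEN iffD1, rotated]) (simp add: h_def)
      then show ?thesis
        by (simp add: Bij_iff h_def)
    qed
    moreover have "w = (\<lambda>(\<delta>, X)\<in>B \<times> P. (h X \<delta>, (\<lambda>X\<in>P. k ` X) X))"
    proof -
      have "f (k (c X \<delta>)) = (h X \<delta>, k ` X)" if "\<delta> \<in> B" "X \<in> P" for \<delta> X
        using that f_eq[OF P_image[OF k(1) that(2)]] bij_betw_apply[OF c_bij] by (simp add: h_def)
      then show ?thesis
        unfolding k(2) by (auto simp: fun_eq_iff g_def)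
    qed
    moreover have "(\<lambda>X\<in>P. k ` X) \<in> block_action K P"
      using k(1) by (simp add: block_action_def)
    ultimately show "w \<in> ?W"
      unfolding imprimitive_wreath_def by blast
  next
    fix w assume "w \<in> ?W"
    then obtain h k where hk: "h \<in> P \<rightarrow> Bij B" "k \<in> K"
      and w: "w = (\<lambda>(\<delta>, X)\<in>B \<times> P. (h X \<delta>, (\<lambda>X\<in>P. k ` X) X))"
      by (auto simp: imprimitive_wreath_def block_action_def)
    obtain k' where k': "k' \<in> K" "\<forall>x\<in>\<Omega>. k' (k x) = x" "\<forall>x\<in>\<Omega>. k (k' x) = x"
      by (rule inverse_ex[OF hk(2)])
    define \<rho> where "\<rho> = (\<lambda>x\<in>\<Omega>. let X = snd (f x) in k' (c (k ` X) (h X (fst (f x)))))"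
    have \<rho>_eq: "\<rho> (c X \<delta>) = k' (c (k ` X) (h X \<delta>))" if "X \<in> P" "\<delta> \<in> B" for X \<delta>
      using fc[OF that] maps[OF c(1)] that B_subset by (auto simp: \<rho>_def Let_def)
    have \<rho>_bij: "bij_betw \<rho> X X" if X: "X \<in> P" for X
    proof -
      have "k' ` k ` X = X"
        using k'(2) P_subset[OF X] by (force simp: image_image)
      moreover have "inj_on k' (k ` X)"
        using inj_subset[OF k'(1)] P_subset[OF P_image[OF hk(2) X]] by blast
      ultimately have "bij_betw k' (k ` X) X"
        by (simp add: bij_betw_def)
      moreover have "bij_betw (h X) B B"
        using hk(1) X by (auto simp: Bij_iff)
      ultimately have "bij_betw (k' \<circ> c (k ` X) \<circ> h X \<circ> inv_into B (c X)) X X"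
        using bij_betw_inv_into[OF c_bij[OF X]] c_bij[OF P_image[OF hk(2) X]]
        by (intro bij_betw_trans)
      moreover have "\<rho> x = (k' \<circ> c (k ` X) \<circ> h X \<circ> inv_into B (c X)) x" if "x \<in> X" for x
        using f_eq[OF X that] P_subset[OF X] that by (auto simp: \<rho>_def Let_def)
      ultimately show ?thesis
        using bij_betw_cong[of X \<rho>] by blast
    qed
    have "\<rho> \<in> N"
      by (intro full block_fixing_Bij) (use \<rho>_bij in \<open>auto simp: bij_betw_def \<rho>_def\<close>)
    then have \<sigma>: "compose \<Omega> k \<rho> \<in> K"
      using compose_closed[OF hk(2)] N_subset by blast
    moreover have "w = ?\<phi> (compose \<Omega> k \<rho>)"
    proof (rule ext)
      fix p
      show "w p = ?\<phi> (compose \<Omega> k \<rho>) p"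
      proof (cases "p \<in> B \<times> P")
        case True
        then obtain \<delta> X where p: "p = (\<delta>, X)" "\<delta> \<in> B" "X \<in> P"
          by blast
        have Y: "k ` X \<in> P"
          using P_image[OF hk(2) p(3)] .
        have h: "h X \<delta> \<in> B"
          using Bij_imp_funcset[OF Pi_mem[OF hk(1) p(3)]] p(2) by (rule funcset_mem)
        have "c X \<delta> \<in> \<Omega>" "c (k ` X) (h X \<delta>) \<in> \<Omega>"
          using maps[OF c(1)] p Y h B_subset by auto
        then have "f (compose \<Omega> k \<rho> (c X \<delta>)) = (h X \<delta>, k ` X)"
          using fc[OF Y h] by (simp add: compose_eq \<rho>_eq p k'(3))
        then show ?thesis
          using p by (simp add: w g_def)
      next
        case False
        then show ?thesis
          by (simp add: w)
      qed
    qed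
    ultimately show "w \<in> ?\<phi> ` K"
      by blast
  qed
  then show ?thesis
    using perm_isomorphic_conjugate[OF permutation_group_axioms g] by (simp add: f_def)
qed

text \<open>The extension is the identity on the other blocks because they are disjoint from
  \<open>X\<close>, so it fixes every block.\<close>

lemma extend_in_kernel:
  assumes full: "\<And>\<sigma>. \<sigma> \<in> Bij \<Omega> \<Longrightarrow> (\<And>X. X \<in> P \<Longrightarrow> \<sigma> ` X = X) \<Longrightarrow> \<sigma> \<in> N"
    and "X \<in> P" "\<sigma> \<in> Bij X"
  shows "(\<lambda>x\<in>\<Omega>. if x \<in> X then \<sigma> x else x) \<in> N" (is "?e \<in> _")
proof (rule full)
  show "?e \<in> Bij \<Omega>"
    using restrict_Bij_extend(1)[OF P_subset[OF assms(2)] assms(3)] .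
  fix Y assume Y: "Y \<in> P"
  show "?e ` Y = Y"
  proof (cases "X = Y")
    case True
    then show ?thesis
      using restrict_Bij_extend(2)[OF P_subset[OF assms(2)] assms(3)] by simp
  next
    case False
    then have "?e y = y" if "y \<in> Y" for y
      using that P_disjoint[OF assms(2) Y] P_subset[OF Y] by auto
    then show ?thesis
      by force
  qed
qed

lemma induced_on_kernel_block:
  assumes full: "\<And>\<sigma>. \<sigma> \<in> Bij \<Omega> \<Longrightarrow> (\<And>X. X \<in> P \<Longrightarrow> \<sigma> ` X = X) \<Longrightarrow> \<sigma> \<in> N"
  shows "induced_on N B = Bij B"
proof
  show "induced_on N B \<subseteq> Bij B"
    unfolding induced_on_def using restrict_image_Bij[OF N.inj_subset[OF _ B_subset]] by blast
  show "Bij B \<subseteq> induced_on N B"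
  proof
    fix \<sigma> assume \<sigma>: "\<sigma> \<in> Bij B"
    let ?e = "\<lambda>x\<in>\<Omega>. if x \<in> B then \<sigma> x else x"
    have "?e \<in> N"
      using full B_in_P \<sigma> by (rule extend_in_kernel)
    moreover have "?e ` B = B"
      using restrict_Bij_extend(2)[OF B_subset \<sigma>] .
    moreover have "restrict ?e B = \<sigma>"
      using B_subset \<sigma> by (auto simp: fun_eq_iff Bij_def extensional_def)
    ultimately show "\<sigma> \<in> induced_on N B"
      unfolding induced_on_def by (intro image_eqI[of _ _ ?e]) auto
  qed
qed

text \<open>On a block other than \<open>B\<close>, a transposition extended by the identity is a
  nontrivial element of the kernel that restricts trivially to \<open>B\<close>, so restriction from
  the union to \<open>B\<close> is not injective. For \<open>X = B\<close> restriction is the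
  identity map of the induced group.\<close>

lemma linked_blocks_iff:
  assumes full: "\<And>\<sigma>. \<sigma> \<in> Bij \<Omega> \<Longrightarrow> (\<And>X. X \<in> P \<Longrightarrow> \<sigma> ` X = X) \<Longrightarrow> \<sigma> \<in> N"
    and "X \<in> P" "finite X" "card X \<ge> 2"
  shows "linked_blocks K P B X \<longleftrightarrow> X = B"
proof
  assume linked: "linked_blocks K P B X"
  show "X = B"
  proof (rule ccontr)
    assume "X \<noteq> B"
    then have disj: "X \<inter> B = {}"
      using P_disjoint[OF assms(2) B_in_P] by blast
    obtain x where x: "x \<in> X"
      using P_nonempty[OF assms(2)] by blast
    obtain y where y: "y \<in> X" "y \<noteq> x"
      using exists_outside[of X "{x}"] assms(3,4) by auto
    let ?t = "restrict (Transposition.transpose x y) X"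
    let ?e = "\<lambda>z\<in>\<Omega>. if z \<in> X then ?t z else z"
    let ?i = "\<lambda>z\<in>\<Omega>. z"
    have sub: "B \<union> X \<subseteq> \<Omega>"
      using B_subset P_subset[OF assms(2)] by blast
    have t: "?t \<in> Bij X"
      using permutes_swap_id[OF x y(1)] by (auto simp: Bij_iff permutes_imp_bij)
    have e: "?e \<in> N"
      using full assms(2) t by (rule extend_in_kernel)
    have in_induced: "restrict k (B \<union> X) \<in> induced_on N (B \<union> X)" if "k \<in> N" for k
      unfolding induced_on_def using N_fixes[OF that B_in_P] N_fixes[OF that assms(2)] that
      by (intro imageI) (simp add: image_Un)
    have "inj_on (\<lambda>f. restrict f B) (induced_on N (B \<union> X))"
      using linked by (simp add: linked_blocks_def iso_def perm_group_def bij_betw_def)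
    moreover have "restrict (restrict ?e (B \<union> X)) B = restrict (restrict ?i (B \<union> X)) B"
      using disj by (auto simp: fun_eq_iff)
    ultimately have "restrict ?e (B \<union> X) = restrict ?i (B \<union> X)"
      using in_induced[OF e] in_induced[OF N.id_closed] by (rule inj_onD)
    then have "restrict ?e (B \<union> X) x = restrict ?i (B \<union> X) x"
      by simp
    then show False
      using x y sub by auto
  qed
next
  assume "X = B"
  define M where "M = induced_on N B"
  have sub: "M \<subseteq> Bij B"
    unfolding M_def induced_on_def using restrict_image_Bij[OF N.inj_subset[OF _ B_subset]] by blast
  have id: "restrict m B = m" if "m \<in> M" for m
    using subsetD[OF sub that] by (simp add: Bij_iff extensional_restrict)
  have closed: "compose B m n \<in> M" if "m \<in> M" "n \<in> M" for m n
  proof -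
    have "M = Bij B"
      unfolding M_def using full by (rule induced_on_kernel_block)
    then show ?thesis
      using that compose_Bij by blast
  qed
  have "(\<lambda>f. restrict f B) \<in> iso (perm_group B M) (perm_group B M)"
    unfolding iso_def
  proof (intro CollectI conjI)
    show "(\<lambda>f. restrict f B) \<in> hom (perm_group B M) (perm_group B M)"
      using sub by (intro homI) (auto simp: perm_group_def BijGroup_def id closed subset_iff)
    show "bij_betw (\<lambda>f. restrict f B) (carrier (perm_group B M)) (carrier (perm_group B M))"
      by (subst bij_betw_cong[of _ _ id]) (auto simp: perm_group_def id)
  qed
  then show "linked_blocks K P B X"
    using \<open>X = B\<close> by (simp add: linked_blocks_def M_def)
qed

end

section \<open>Overgroups of \<open>G\<^sup>*\<close> for almost simple \<open>G\<close>\<close>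

text \<open>Three successive transpositions put the values in place, each leaving the values already
  reached alone. If the result is odd, a transposition of two points outside
  \<open>{a, b, c}\<close> is applied first; hence the bound of five points.\<close>

lemma even_permutation_extension:
  assumes "finite X" "card X \<ge> 5" "{a, b, c} \<subseteq> X" "{x, y, z} \<subseteq> X"
    "a \<noteq> b" "b \<noteq> c" "a \<noteq> c" "x \<noteq> y" "y \<noteq> z" "x \<noteq> z"
  obtains p where "p permutes X" "evenperm p" "p a = x" "p b = y" "p c = z"
proof -
  define p1 where "p1 = Transposition.transpose a x"
  define p2 where "p2 = Transposition.transpose (p1 b) y"
  define p3 where "p3 = Transposition.transpose (p2 (p1 c)) z"
  define p where "p = p3 \<circ> (p2 \<circ> p1)"
  have p1: "p1 permutes X" "p1 a = x"
    using assms(3,4) permutes_swap_id by (auto simp: p1_def)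
  have p2: "p2 permutes X" "p2 (p1 b) = y"
    using assms(3,4) by (simp_all add: p2_def permutes_swap_id permutes_in_image[OF p1(1)])
  have p3: "p3 permutes X" "p3 (p2 (p1 c)) = z"
    using assms(3,4)
    by (simp_all add: p3_def permutes_swap_id permutes_in_image[OF p1(1)] permutes_in_image[OF p2(1)])
  have "p1 b \<noteq> x" "p1 c \<noteq> x" "p1 c \<noteq> p1 b"
    using assms p1(2) inj_eq[OF permutes_inj[OF p1(1)]] by metis+
  then have "p2 x = x" "p2 (p1 c) \<noteq> x" "p2 (p1 c) \<noteq> y"
    using assms(8) p2(2) inj_eq[OF permutes_inj[OF p2(1)]] transpose_apply_other[of x "p1 b" y]
    unfolding p2_def by metis+
  then have "p3 x = x" "p3 y = y"
    using assms(9,10) by (auto simp: p3_def transpose_apply_other)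
  then have p: "p permutes X" "p a = x" "p b = y" "p c = z"
    using p1 p2 p3 \<open>p2 x = x\<close> by (auto simp: p_def intro!: permutes_compose)
  show ?thesis
  proof (cases "evenperm p")
    case True
    then show ?thesis
      using p that by blast
  next
    case False
    have "card (X - {a, b, c}) \<ge> 2"
      using assms by (subst card_Diff_subset) auto
    then obtain u where u: "u \<in> X - {a, b, c}"
      by (metis all_not_in_conv card.empty not_numeral_le_zero)
    obtain v where v: "v \<in> X - {a, b, c}" "v \<noteq> u"
      using \<open>card (X - {a, b, c}) \<ge> 2\<close> exists_outside[of "X - {a, b, c}" "{u}"] assms(1) by auto
    let ?t = "Transposition.transpose u v"
    have "evenperm (p \<circ> ?t)"
      using False v(2) permutes_imp_permutation[OF assms(1) p(1)] permutation_swap_id[of u v]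
      by (simp add: evenperm_comp evenperm_swap)
    moreover have "p \<circ> ?t permutes X"
      using u v p(1) by (intro permutes_compose permutes_swap_id) auto
    moreover have "?t a = a" "?t b = b" "?t c = c"
      using u v by (auto intro!: transpose_apply_other)
    ultimately show ?thesis
      using that[of "p \<circ> ?t"] p by simp
  qed
qed

lemma restrict_permutes_Bij:
  assumes "p permutes X"
  shows "restrict p X \<in> Bij X"
  using assms by (simp add: Bij_iff permutes_imp_bij)

lemma (in group) mult_inv_cancel:
  assumes "x \<in> carrier G" "y \<in> carrier G"
  shows "x \<otimes> (inv x \<otimes> y) = y" "inv x \<otimes> (x \<otimes> y) = y"
  using assms by (simp_all add: m_assoc[symmetric])

section \<open>The socle, blocks as normal subgroups, and the minimal block\<close>

locale almost_simple_overgroup = permutation_group "carrier G" K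
  for G :: "('a, 'b) monoid_scheme" (structure) and K +
  assumes fin: "finite (carrier G)" and almost_simple: "almost_simple G" and star: "star_group G \<subseteq> K"
begin

sublocale group G
  using almost_simple by (simp add: almost_simple_def)

abbreviation S where "S \<equiv> socle G"

lemma socle_subgroup: "subgroup S G"
  unfolding socle_def
proof (rule generate_is_subgroup, rule Union_least)
  fix M assume "M \<in> {M. minimal_normal G M}"
  then show "M \<subseteq> carrier G"
    using subgroup.subset[OF normal_imp_subgroup] unfolding minimal_normal_def by blast
qed

lemma socle_noncomm:
  obtains a b where "a \<in> S" "b \<in> S" "a \<otimes> b \<noteq> b \<otimes> a"
proof -
  have "group (G\<lparr>carrier := S\<rparr>)"
    using socle_subgroup by (rule subgroup_imp_group)
  moreover have "\<not> comm_group (G\<lparr>carrier := S\<rparr>)"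
    using almost_simple by (simp add: almost_simple_def)
  ultimately show ?thesis
    using group.group_comm_groupI[of "G\<lparr>carrier := S\<rparr>"] that by auto
qed

lemma minimal_normal_exists:
  assumes "M \<lhd> G" "M \<noteq> {\<one>}"
  obtains M' where "minimal_normal G M'" "M' \<subseteq> M"
proof -
  have "finite (Collect (\<lambda>M. M \<lhd> G \<and> M \<noteq> {\<one>}))"
    by (rule finite_subset[of _ "Pow (carrier G)"])
      (auto simp: fin dest: normal_imp_subgroup subgroup.subset)
  then obtain M' where M': "M' \<lhd> G \<and> M' \<noteq> {\<one>}" "M' \<subseteq> M"
    "\<And>M''. M'' \<lhd> G \<and> M'' \<noteq> {\<one>} \<Longrightarrow> M'' \<subseteq> M' \<Longrightarrow> M' = M''"
    using finite_has_minimal2[of "Collect (\<lambda>M. M \<lhd> G \<and> M \<noteq> {\<one>})" M] assms by auto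
  then have "minimal_normal G M'"
    unfolding minimal_normal_def by blast
  then show ?thesis
    using M'(2) that by blast
qed

text \<open>A minimal normal subgroup inside \<open>M\<close> lies in the socle and is normal there,
  so by simplicity it is the whole socle.\<close>

lemma socle_subset_normal:
  assumes "M \<lhd> G" "M \<noteq> {\<one>}"
  shows "S \<subseteq> M"
proof -
  obtain M' where M': "minimal_normal G M'" "M' \<subseteq> M"
    using minimal_normal_exists[OF assms] .
  have "M' \<subseteq> S"
    unfolding socle_def using M'(1) by (auto intro: generate.incl)
  then have "M' \<lhd> G\<lparr>carrier := S\<rparr>"
    using M'(1) normal_restrict_supergroup[OF socle_subgroup] by (simp add: minimal_normal_def)
  then have "M' = S \<or> M' = {\<one>}"
    using almost_simple simple_group.no_real_normal_subgroup[of "G\<lparr>carrier := S\<rparr>" M']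
    by (simp add: almost_simple_def)
  then show ?thesis
    using M' by (auto simp: minimal_normal_def)
qed

text \<open>The two-sided form covers left and right translations and conjugations at once.\<close>

lemma translation_in_K:
  assumes "x \<in> carrier G" "y \<in> carrier G"
  shows "(\<lambda>g\<in>carrier G. x \<otimes> g \<otimes> y) \<in> K"
proof -
  let ?l = "\<lambda>g\<in>carrier G. x \<otimes> g" and ?r = "\<lambda>g\<in>carrier G. g \<otimes> y"
  have "bij_betw ?l (carrier G) (carrier G)"
    using assms(1) by (intro bij_betw_byWitness[where f' = "\<lambda>g. inv x \<otimes> g"]) (auto simp: m_assoc[symmetric])
  moreover have "bij_betw ?r (carrier G) (carrier G)"
    using assms(2) by (intro bij_betw_byWitness[where f' = "\<lambda>g. g \<otimes> inv y"]) (auto simp: m_assoc)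
  ultimately have "?l \<in> Bij (carrier G)" "?r \<in> Bij (carrier G)"
    by (auto simp: Bij_iff)
  then have "?l \<otimes>\<^bsub>BijGroup (carrier G)\<^esub> ?r = (\<lambda>g\<in>carrier G. x \<otimes> g \<otimes> y)"
    using assms by (auto simp: BijGroup_def compose_def fun_eq_iff m_assoc)
  moreover have "?l \<otimes>\<^bsub>BijGroup (carrier G)\<^esub> ?r \<in> star_group G"
    unfolding star_group_def set_mult_def left_mults_def right_mults_def using assms by blast
  ultimately show ?thesis
    using star by auto
qed

lemma K_transitive:
  assumes "x \<in> carrier G" "y \<in> carrier G"
  shows "\<exists>k\<in>K. k x = y"
  using assms by (intro bexI[OF _ translation_in_K[of "y \<otimes> inv x" \<one>]]) (auto simp: m_assoc)

text \<open>The map with factors \<open>x\<close> and \<open>y\<close> sends \<open>\<one>\<close>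
  to \<open>x \<otimes> y\<close>, so it preserves \<open>B\<close> once this product lies in
  \<open>B\<close>. Taking \<open>y = \<one>\<close> gives closure under products, and
  \<open>y = inv x\<close> closure under conjugation. Left translation by \<open>inv b\<close> sends
  \<open>b\<close> to \<open>\<one>\<close>, so it preserves \<open>B\<close> too and gives
  inverses.\<close>

lemma block_normal:
  assumes B: "block (carrier G) K B" and one: "\<one> \<in> B"
  shows "B \<lhd> G"
proof -
  have sub: "B \<subseteq> carrier G"
    using B by (simp add: block_def)
  have move: "x \<otimes> b \<otimes> y \<in> B" if "x \<in> carrier G" "y \<in> carrier G" "x \<otimes> y \<in> B" "b \<in> B" for x y b
  proof -
    let ?t = "\<lambda>g\<in>carrier G. x \<otimes> g \<otimes> y"
    have "?t \<one> \<in> ?t ` B \<inter> B"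
      using that one by (intro IntI imageI) auto
    then have "?t ` B = B"
      using B translation_in_K[OF that(1,2)] unfolding block_def by blast
    then have "?t b \<in> B"
      using that(4) by blast
    then show ?thesis
      using that(4) sub by auto
  qed
  have inv_B: "inv b \<in> B" if b: "b \<in> B" for b
  proof -
    let ?t = "\<lambda>g\<in>carrier G. inv b \<otimes> g \<otimes> \<one>"
    have bG: "b \<in> carrier G"
      using b sub by blast
    have "?t b = \<one>"
      using bG by simp
    then have "?t ` B \<inter> B \<noteq> {}"
      using one b by (metis IntI emptyE imageI)
    then have "?t ` B = B"
      using B translation_in_K[of "inv b" \<one>] bG unfolding block_def by blast
    then have "?t \<one> \<in> B"
      using one by blast
    then show ?thesis
      using bG by simp
  qed
  show ?thesis
  proof (rule normal_invI)
    show "subgroup B G"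
    proof (rule subgroupI)
      show "x \<otimes> y \<in> B" if "x \<in> B" "y \<in> B" for x y
        using move[of x \<one> y] that sub by (auto simp: subset_iff)
    qed (use sub one inv_B in auto)
    show "x \<otimes> h \<otimes> inv x \<in> B" if "x \<in> carrier G" "h \<in> B" for x h
      using move[of x "inv x" h] that one by simp
  qed
qed

abbreviation L where "L \<equiv> minimal_block G K"

text \<open>Puts the whole group among the sets intersected in \<open>minimal_block\<close>, so that
  this intersection stays inside the carrier.\<close>

lemma carrier_nontrivial: "carrier G \<noteq> {\<one>}"
proof
  assume triv: "carrier G = {\<one>}"
  obtain a b where ab: "a \<in> S" "b \<in> S" "a \<otimes> b \<noteq> b \<otimes> a"
    by (rule socle_noncomm)
  then have "a = \<one>" "b = \<one>"
    using subgroup.subset[OF socle_subgroup] triv by auto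
  with ab(3) show False
    by simp
qed

lemma carrier_block: "block (carrier G) K (carrier G)"
  using bij by (auto simp: block_def bij_betw_def)

lemma L_subset: "L \<subseteq> carrier G"
  unfolding minimal_block_def using carrier_block carrier_nontrivial by blast

lemma one_in_L: "\<one> \<in> L"
  by (simp add: minimal_block_def)

lemma L_block: "block (carrier G) K L"
proof -
  have "k ` L = L" if k: "k \<in> K" and meet: "k ` L \<inter> L \<noteq> {}" for k
  proof -
    let ?Bs = "{B. block (carrier G) K B \<and> \<one> \<in> B \<and> B \<noteq> {\<one>}}"
    have fixed: "k ` B = B" if "B \<in> ?Bs" for B
    proof -
      have "L \<subseteq> B"
        using that by (auto simp: minimal_block_def)
      then have "k ` B \<inter> B \<noteq> {}"
        using meet by blast
      then show ?thesis
        using that k unfolding block_def by blast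
    qed
    have "inj_on k (carrier G)" "carrier G \<in> ?Bs" "\<forall>B\<in>?Bs. B \<subseteq> carrier G"
      using inj[OF k] carrier_block carrier_nontrivial by (auto simp: block_def)
    then have "k ` (\<Inter>B\<in>?Bs. B) = (\<Inter>B\<in>?Bs. k ` B)"
      by (intro image_INT[of _ "carrier G" _ "\<lambda>B. B"]) auto
    also have "\<dots> = (\<Inter>B\<in>?Bs. B)"
      by (rule INF_cong[OF refl fixed])
    finally show ?thesis
      by (simp add: minimal_block_def)
  qed
  then show ?thesis
    unfolding block_def using L_subset one_in_L by blast
qed

text \<open>Every block of the intersected family is a nontrivial normal subgroup and so contains
  the socle. In particular the intersection does not shrink to \<open>{\<one>}\<close>.\<close>

lemma socle_subset_L: "S \<subseteq> L"
  unfolding minimal_block_def using socle_subset_normal block_normal by blast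

lemma L_normal: "L \<lhd> G"
  using block_normal L_block one_in_L .

sublocale transitive_block "carrier G" K L
  using L_block K_transitive by unfold_locales

lemma L_mult: "x \<in> L \<Longrightarrow> y \<in> L \<Longrightarrow> x \<otimes> y \<in> L" and L_inv: "x \<in> L \<Longrightarrow> inv x \<in> L"
  using normal_imp_subgroup[OF L_normal] by (auto simp: subgroup.m_closed subgroup.m_inv_closed)

text \<open>The centralizer \<open>C\<close> of a normal subgroup is normal. If it were nontrivial
  it would contain the socle, which lies in \<open>L\<close> and would then be commutative.\<close>

lemma centralizer_L:
  assumes g: "g \<in> carrier G" and comm: "\<And>x. x \<in> L \<Longrightarrow> x \<otimes> g = g \<otimes> x"
  shows "g = \<one>"
proof -
  define C where "C = {g \<in> carrier G. \<forall>x\<in>L. x \<otimes> g = g \<otimes> x}"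
  have LG: "x \<in> carrier G" if "x \<in> L" for x
    using L_subset that by blast
  have "C \<lhd> G"
  proof (rule normal_invI)
    show "subgroup C G"
    proof (rule subgroupI)
      show "C \<subseteq> carrier G" "C \<noteq> {}"
        using LG by (auto simp: C_def intro!: exI[of _ \<one>])
      show "inv c \<in> C" if c: "c \<in> C" for c
      proof -
        have cG: "c \<in> carrier G"
          using c by (simp add: C_def)
        have "x \<otimes> inv c = inv c \<otimes> x" if x: "x \<in> L" for x
        proof -
          have "x \<otimes> inv c = inv c \<otimes> (c \<otimes> x) \<otimes> inv c"
            using cG LG[OF x] by (simp add: m_assoc[symmetric])
          also have "\<dots> = inv c \<otimes> (x \<otimes> c) \<otimes> inv c"
            using c x by (simp add: C_def)
          also have "\<dots> = inv c \<otimes> x"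
            using cG LG[OF x] by (simp add: m_assoc)
          finally show ?thesis .
        qed
        then show ?thesis
          using cG by (simp add: C_def)
      qed
      show "c \<otimes> d \<in> C" if "c \<in> C" "d \<in> C" for c d
      proof -
        have cd: "c \<in> carrier G" "d \<in> carrier G"
          using that by (auto simp: C_def)
        have "x \<otimes> (c \<otimes> d) = c \<otimes> d \<otimes> x" if x: "x \<in> L" for x
        proof -
          have "x \<otimes> (c \<otimes> d) = c \<otimes> x \<otimes> d"
            using cd LG[OF x] \<open>c \<in> C\<close> x by (simp add: C_def m_assoc[symmetric])
          also have "\<dots> = c \<otimes> d \<otimes> x"
            using cd LG[OF x] \<open>d \<in> C\<close> x by (simp add: C_def m_assoc)
          finally show ?thesis .
        qed
        then show ?thesis
          using cd by (simp add: C_def)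
      qed
    qed
    show "h \<otimes> c \<otimes> inv h \<in> C" if h: "h \<in> carrier G" and c: "c \<in> C" for h c
    proof -
      have cG: "c \<in> carrier G"
        using c by (simp add: C_def)
      have "x \<otimes> (h \<otimes> c \<otimes> inv h) = h \<otimes> c \<otimes> inv h \<otimes> x" if x: "x \<in> L" for x
      proof -
        \<comment> \<open>Commuting with \<open>x\<close> is reduced to \<open>c\<close> commuting
          with a conjugate of \<open>x\<close>, again in \<open>L\<close>.\<close>
        define y where "y = inv h \<otimes> x \<otimes> h"
        have y: "y \<in> L" "y \<in> carrier G"
          using normal.inv_op_closed1[OF L_normal h x] LG by (auto simp: y_def)
        have x_eq: "x = h \<otimes> y \<otimes> inv h"
          using h LG[OF x] by (simp add: y_def m_assoc mult_inv_cancel)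
        have "x \<otimes> (h \<otimes> c \<otimes> inv h) = h \<otimes> (y \<otimes> c) \<otimes> inv h"
          unfolding x_eq using h y(2) cG by (simp add: m_assoc mult_inv_cancel)
        also have "\<dots> = h \<otimes> (c \<otimes> y) \<otimes> inv h"
          using c y(1) by (simp add: C_def)
        also have "\<dots> = h \<otimes> c \<otimes> inv h \<otimes> x"
          unfolding x_eq using h y(2) cG by (simp add: m_assoc mult_inv_cancel)
        finally show ?thesis .
      qed
      then show ?thesis
        using cG h by (simp add: C_def)
    qed
  qed
  moreover have "\<not> S \<subseteq> C"
  proof
    assume "S \<subseteq> C"
    obtain a b where "a \<in> S" "b \<in> S" "a \<otimes> b \<noteq> b \<otimes> a"
      by (rule socle_noncomm)
    then show False
      using \<open>S \<subseteq> C\<close> socle_subset_L by (auto simp: C_def subset_iff)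
  qed
  ultimately have "C = {\<one>}"
    using socle_subset_normal by blast
  then show ?thesis
    using g comm by (auto simp: C_def)
qed

section \<open>Translations in the kernel and three-cycles on \<open>L\<close>\<close>

text \<open>Blocks are cosets of the normal subgroup \<open>L\<close>, and
  \<open>x \<otimes> g \<otimes> y\<close> is \<open>g\<close> times the element
  \<open>inv g \<otimes> x \<otimes> g \<otimes> y\<close> of \<open>L\<close>.\<close>

lemma translation_in_N:
  assumes "x \<in> L" "y \<in> L"
  shows "(\<lambda>g\<in>carrier G. x \<otimes> g \<otimes> y) \<in> N" (is "?t \<in> N")
proof (rule N_I)
  have xy: "x \<in> carrier G" "y \<in> carrier G"
    using assms L_subset by auto
  then show t: "?t \<in> K"
    by (rule translation_in_K)
  fix X assume X: "X \<in> P"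
  then obtain k where k: "k \<in> K" "X = k ` L"
    by (auto simp: block_system_def)
  define g where "g = k \<one>"
  have g: "g \<in> carrier G" "g \<in> X"
    using maps[OF k(1)] one_in_L k(2) by (auto simp: g_def)
  define z where "z = inv g \<otimes> x \<otimes> g \<otimes> y"
  have z: "z \<in> L" "z \<in> carrier G"
    using normal.inv_op_closed1[OF L_normal g(1) assms(1)] assms(2) L_mult L_subset by (auto simp: z_def)
  \<comment> \<open>Left translation by \<open>g\<close> maps \<open>L\<close> to a block containing
    \<open>g\<close>, which must be \<open>X\<close>; this identifies \<open>X\<close> as the coset
    of \<open>g\<close>.\<close>
  let ?s = "\<lambda>h\<in>carrier G. g \<otimes> h \<otimes> \<one>"
  have "?s ` L \<in> P"
    using P_image[OF translation_in_K[OF g(1) one_closed] B_in_P] .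
  moreover have "?s \<one> \<in> ?s ` L" "?s z \<in> ?s ` L"
    using one_in_L z by blast+
  ultimately have "g \<otimes> z \<in> X"
    using P_disjoint[OF _ X, of "?s ` L" g] g z by auto
  moreover have "?t g = g \<otimes> z"
    using g(1) xy by (simp add: z_def m_assoc mult_inv_cancel)
  ultimately have "?t g \<in> X"
    by simp
  moreover have "?t g \<in> ?t ` X"
    using g(2) by (rule imageI)
  ultimately show "?t ` X = X"
    using P_disjoint[OF P_image[OF t X] X] by blast
qed

text \<open>For noncommuting \<open>a\<close>, \<open>b\<close> in the socle the elements
  \<open>\<one>\<close>, \<open>a\<close>, \<open>b\<close>, \<open>a \<otimes> b\<close>,
  \<open>b \<otimes> a\<close> are distinct.\<close>

lemma card_L: "card L \<ge> 5"
proof -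
  obtain a b where ab: "a \<in> S" "b \<in> S" "a \<otimes> b \<noteq> b \<otimes> a"
    by (rule socle_noncomm)
  then have L: "a \<in> L" "b \<in> L" "a \<in> carrier G" "b \<in> carrier G"
    using socle_subset_L L_subset by auto
  have "a \<otimes> b \<noteq> \<one>" "b \<otimes> a \<noteq> \<one>"
    using ab(3) L(3,4) inv_comm[of a b] inv_comm[of b a] by auto
  moreover have "a \<noteq> \<one>" "b \<noteq> \<one>" "a \<noteq> b"
    using ab(3) L(3,4) by auto
  moreover from this have "a \<otimes> b \<noteq> a" "a \<otimes> b \<noteq> b" "b \<otimes> a \<noteq> a" "b \<otimes> a \<noteq> b"
    using L(3,4) by (auto simp: l_cancel_one r_cancel_one)
  ultimately have "card {\<one>, a, b, a \<otimes> b, b \<otimes> a} = 5"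
    using ab(3) by auto
  moreover have "{\<one>, a, b, a \<otimes> b, b \<otimes> a} \<subseteq> L"
    using L one_in_L L_mult by auto
  ultimately show ?thesis
    using card_mono[OF finite_subset[OF L_subset fin]] by metis
qed

text \<open>For each \<open>x\<close> in \<open>L\<close> the kernel contains a translation with
  left factor \<open>x\<close> that fixes \<open>u\<close>. If all of these fix \<open>y\<close>,
  then \<open>y \<otimes> inv u\<close> centralizes \<open>L\<close>, so \<open>y = u\<close>,
  although their blocks are disjoint.\<close>

lemma no_common_fixed_point:
  assumes XY: "X \<in> P" "Y \<in> P" "X \<noteq> Y" and u: "u \<in> X" and y: "y \<in> Y"
  shows "\<exists>k\<in>N. k u = u \<and> k y \<noteq> y"
proof (rule ccontr)
  assume no: "\<not> ?thesis"
  have G: "u \<in> carrier G" "y \<in> carrier G"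
    using P_subset XY u y by auto
  have "x \<otimes> (y \<otimes> inv u) = (y \<otimes> inv u) \<otimes> x" if x: "x \<in> L" for x
  proof -
    have xG: "x \<in> carrier G"
      using x L_subset by blast
    \<comment> \<open>The right factor forced by \<open>x \<otimes> u \<otimes> w = u\<close>; it
      lies in \<open>L\<close> by normality.\<close>
    define w where "w = inv u \<otimes> inv x \<otimes> u"
    have w: "w \<in> L" "w \<in> carrier G"
      using normal.inv_op_closed1[OF L_normal G(1) L_inv[OF x]] L_subset by (auto simp: w_def)
    let ?t = "\<lambda>g\<in>carrier G. x \<otimes> g \<otimes> w"
    have "?t u = u"
      using G xG by (simp add: w_def m_assoc mult_inv_cancel)
    then have "?t y = y"
      using no translation_in_N[OF x w(1)] by blast
    then have "x \<otimes> y \<otimes> w = y"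
      using G by simp
    \<comment> \<open>Multiplying by \<open>inv u \<otimes> x\<close> cancels \<open>w\<close>, as
      \<open>w \<otimes> inv u \<otimes> x = inv u\<close>.\<close>
    then have "x \<otimes> y \<otimes> w \<otimes> inv u \<otimes> x = y \<otimes> inv u \<otimes> x"
      by simp
    moreover have "x \<otimes> y \<otimes> w \<otimes> inv u \<otimes> x = x \<otimes> (y \<otimes> inv u)"
      using G xG by (simp add: w_def m_assoc)
    ultimately show ?thesis
      by simp
  qed
  then have "y \<otimes> inv u = \<one>"
    using G by (intro centralizer_L) auto
  then have "y = u"
    using G inv_equality[of y "inv u"] by simp
  then show False
    using P_disjoint XY u y by blast
qed

text \<open>Conjugation by a noncentral \<open>a \<in> L\<close> fixes \<open>\<one>\<close> and \<open>a\<close> and moves some \<open>b\<close> to \<open>q \<noteq> b\<close>, so its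
  commutator with the three-cycle \<open>(b \<one> a)\<close> is the three-cycle \<open>(\<one> b q)\<close>.\<close>

lemma three_cycles_L:
  assumes alt: "alternating L \<subseteq> induced_on K L"
  shows "has_three_cycles N L"
proof -
  have finL: "finite L"
    using L_subset fin finite_subset by blast
  have lift: "\<exists>d\<in>K. d ` L = L \<and> (\<forall>x\<in>L. d x = p x)" if "p permutes L" "evenperm p" for p
  proof -
    have "restrict p L \<in> induced_on K L"
      using alt that by (auto simp: alternating_def)
    then obtain d where "d \<in> K" "d ` L = L" "restrict p L = restrict d L"
      by (auto simp: induced_on_def)
    then show ?thesis
      by (metis restrict_apply')
  qed
  obtain a b where ab: "a \<in> S" "b \<in> S" "a \<otimes> b \<noteq> b \<otimes> a"
    by (rule socle_noncomm)
  then have L: "a \<in> L" "b \<in> L" "a \<in> carrier G" "b \<in> carrier G"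
    using socle_subset_L L_subset by auto
  have ne: "a \<noteq> \<one>" "b \<noteq> \<one>" "a \<noteq> b"
    using ab(3) L(3,4) by auto
  define m where "m = (\<lambda>g\<in>carrier G. a \<otimes> g \<otimes> inv a)"
  define q where "q = m b"
  have m: "m \<in> N" "m \<one> = \<one>" "m a = a"
    unfolding m_def using translation_in_N[OF L(1) L_inv[OF L(1)]] L by (auto simp: m_assoc)
  have mK: "m \<in> K"
    using N_subset m(1) .
  have mL: "m x \<in> L" if "x \<in> L" for x
    using N_maps[OF m(1) B_in_P that] .
  have m_eq: "m x = m y \<longleftrightarrow> x = y" if "x \<in> L" "y \<in> L" for x y
    using eq_iff[OF mK] that L_subset by blast
  have q: "q \<in> L" "q \<noteq> \<one>" "q \<noteq> a"
    using mL[OF L(2)] m_eq[OF L(2) one_in_L] m_eq[OF L(2,1)] m ne by (auto simp: q_def)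
  have "q \<noteq> b"
  proof
    assume "q = b"
    then have "a \<otimes> b \<otimes> inv a = b"
      using L by (simp add: q_def m_def)
    then have "a \<otimes> b \<otimes> inv a \<otimes> a = b \<otimes> a"
      by simp
    then show False
      using L ab(3) by (simp add: m_assoc)
  qed
  \<comment> \<open>The right-hand factor acts first, so this is the cycle \<open>b\<close> to
    \<open>\<one>\<close> to \<open>a\<close> to \<open>b\<close>.\<close>
  let ?p = "Transposition.transpose b \<one> \<circ> Transposition.transpose \<one> a"
  have "?p permutes L"
    using L one_in_L by (intro permutes_compose permutes_swap_id)
  moreover have "evenperm ?p"
    using ne by (simp add: evenperm_comp permutation_swap_id evenperm_swap)
  ultimately obtain c where c: "c \<in> K" "c ` L = L" "\<And>x. x \<in> L \<Longrightarrow> c x = ?p x"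
    using lift by blast
  have cv: "c b = \<one>" "c \<one> = a" "c a = b" "\<And>x. x \<in> L \<Longrightarrow> x \<notin> {\<one>, a, b} \<Longrightarrow> c x = x"
    using ne L one_in_L by (auto simp: c(3) Transposition.transpose_def)
  obtain m' where m': "m' \<in> N" "\<forall>x\<in>carrier G. m' (m x) = x" "\<forall>x\<in>carrier G. m (m' x) = x"
    by (rule N.inverse_ex[OF m(1)])
  \<comment> \<open>Here \<open>n\<close> is the conjugate by \<open>c\<close> of the inverse of
    \<open>m\<close>. Thus the commutator \<open>k\<close> of \<open>m\<close> and \<open>c\<close>
    lies in the kernel, although \<open>c\<close> is only known to lie in \<open>K\<close>.\<close>
  obtain n where n: "n \<in> N" "\<And>x. x \<in> carrier G \<Longrightarrow> n (c x) = c (m' x)"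
    using N_normal[OF c(1) m'(1)] by blast
  define k where "k = compose (carrier G) m n"
  have k: "k \<in> N"
    unfolding k_def using N.compose_closed m(1) n(1) .
  have LG: "x \<in> carrier G" if "x \<in> L" for x
    using that L_subset by blast
  \<comment> \<open>The commutator relation without inverses; each value of \<open>k\<close> below
    comes from a suitable \<open>x\<close>.\<close>
  have k_eq: "k (c (m x)) = m (c x)" if "x \<in> L" for x
    using that m'(2) n(2) LG mL maps[OF c(1)] by (simp add: k_def compose_eq)
  have k_one: "k \<one> = b"
  proof -
    \<comment> \<open>The preimage of \<open>b\<close> under \<open>m\<close> avoids
      \<open>\<one>\<close>, \<open>a\<close> and \<open>b\<close>, so \<open>c\<close> fixes
      it.\<close>
    obtain r where r: "r \<in> L" "m r = b"
      using N_fixes[OF m(1) B_in_P] L(2) by (metis imageE)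
    then have "r \<notin> {\<one>, a, b}"
      using m ne \<open>q \<noteq> b\<close> by (auto simp: q_def)
    then show ?thesis
      using k_eq[OF r(1)] cv r by simp
  qed
  have "three_cycle_on L k \<one> b q"
    unfolding three_cycle_on_def
  proof (intro conjI ballI)
    show "k \<one> = b" by fact
    show "k b = q"
      using k_eq[OF L(1)] m cv by (simp add: q_def)
    show "k q = \<one>"
      using k_eq[OF L(2)] m cv(4)[OF q(1)] cv q \<open>q \<noteq> b\<close> by (simp add: q_def[symmetric])
    fix w assume w: "w \<in> L - {\<one>, b, q}"
    show "k w = w"
    proof (cases "w = a")
      case True
      then show ?thesis
        using k_eq[OF one_in_L] m cv by simp
    next
      case False
      obtain x where x: "x \<in> L" "m x = w"
        using N_fixes[OF m(1) B_in_P] w by (metis DiffD1 imageE)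
      then have "x \<notin> {\<one>, a, b}"
        using m w False by (auto simp: q_def)
      then show ?thesis
        using k_eq[OF x(1)] cv(4)[of x] cv(4)[of w] x w False by simp
    qed
  qed
  then have cycle: "three_cycle_on L k \<one> b q" .
  show ?thesis
    unfolding has_three_cycles_def
  proof (intro ballI impI)
    fix x y z assume xyz: "x \<in> L" "y \<in> L" "z \<in> L" "x \<noteq> y \<and> y \<noteq> z \<and> x \<noteq> z"
    \<comment> \<open>One three-cycle gives all others: an even permutation taking
      \<open>\<one>\<close>, \<open>b\<close>, \<open>q\<close> to \<open>x\<close>,
      \<open>y\<close>, \<open>z\<close> is induced by some \<open>d\<close> in \<open>K\<close>,
      and conjugation by \<open>d\<close> relabels the cycle.\<close>
    obtain p where p: "p permutes L" "evenperm p" "p \<one> = x" "p b = y" "p q = z"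
      using even_permutation_extension[OF finL card_L, of \<one> b q x y z] xyz L(2) one_in_L q ne(2) \<open>q \<noteq> b\<close>
      by blast
    obtain d where d: "d \<in> K" "d ` L = L" "\<forall>x\<in>L. d x = p x"
      using lift[OF p(1,2)] by blast
    have "d \<one> = x" "d b = y" "d q = z"
      using d(3) p(3-5) one_in_L L(2) q(1) by auto
    then show "\<exists>k\<in>N. three_cycle_on L k x y z"
      using three_cycle_transport[OF d(1) L_subset d(2) k cycle one_in_L L(2) q(1)] by metis
  qed
qed

section \<open>The doubly transitive case\<close>

lemma two_transitive_two_closed_eq_Bij:
  assumes closed: "two_closed (carrier G) K" and tt: "two_transitive (carrier G) K"
  shows "K = Bij (carrier G)"
proof
  show "K \<subseteq> Bij (carrier G)"
    using in_Bij by blast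
  show "Bij (carrier G) \<subseteq> K"
  proof
    fix \<sigma> assume \<sigma>: "\<sigma> \<in> Bij (carrier G)"
    show "\<sigma> \<in> K"
    proof (rule two_closed_memI[OF fin closed \<sigma>])
      fix u v assume uv: "u \<in> carrier G" "v \<in> carrier G"
      have \<sigma>_in: "\<sigma> u \<in> carrier G" "\<sigma> v \<in> carrier G"
        using Bij_imp_funcset[OF \<sigma>] uv by auto
      show "\<exists>k\<in>K. k u = \<sigma> u \<and> k v = \<sigma> v"
      proof (cases "u = v")
        case True
        then show ?thesis
          using K_transitive[OF uv(1) \<sigma>_in(1)] by blast
      next
        case False
        then have "\<sigma> u \<noteq> \<sigma> v"
          using \<sigma> uv by (auto simp: Bij_def bij_betw_def inj_on_def)
        then show ?thesis
          using tt uv \<sigma>_in False unfolding two_transitive_def by blast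
      qed
    qed
  qed
qed

text \<open>In the doubly transitive case \<open>K\<close> is the full symmetric group on the
  carrier, so it contains the extension by the identity of every permutation of
  \<open>L\<close>.\<close>

lemma symmetric_type_alternating:
  assumes closed: "two_closed (carrier G) K" and "symmetric_type G K"
  shows "alternating L \<subseteq> induced_on K L"
proof -
  consider "alternating L \<subseteq> induced_on K L" | "two_transitive (carrier G) K"
    using assms(2) by (auto simp: symmetric_type_def)
  then show ?thesis
  proof cases
    case 1
    then show ?thesis .
  next
    case 2
    have "Bij L \<subseteq> induced_on K L"
    proof
      fix \<sigma> assume \<sigma>: "\<sigma> \<in> Bij L"
      let ?e = "\<lambda>x\<in>carrier G. if x \<in> L then \<sigma> x else x"
      show "\<sigma> \<in> induced_on K L"
        unfolding induced_on_def
      proof (rule image_eqI[of _ _ ?e])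
        show "\<sigma> = restrict ?e L"
          using L_subset \<sigma> by (auto simp: fun_eq_iff Bij_def extensional_def)
        have "?e \<in> K"
          using restrict_Bij_extend(1)[OF L_subset \<sigma>] two_transitive_two_closed_eq_Bij[OF closed 2] by blast
        then show "?e \<in> {k \<in> K. k ` L = L}"
          using restrict_Bij_extend(2)[OF L_subset \<sigma>] by blast
      qed
    qed
    then show ?thesis
      using restrict_permutes_Bij by (auto simp: alternating_def)
  qed
qed

end

section \<open>The principal section and the wreath product structure\<close>

theorem theorem6p2:
  fixes G :: "('a, 'b) monoid_scheme"
    and K :: "('a \<Rightarrow> 'a) set"
    and U L :: "'a set"
    and \<UU> \<LL> :: "'a set set"
  assumes "finite (carrier G)"
    and "almost_simple G"
    and "subgroup K (BijGroup (carrier G))"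
    and "two_closed (carrier G) K"
    and "star_group G \<subseteq> K"
    and "symmetric_type G K"
    and "principal_section G K U L \<UU> \<LL>"
  shows "\<LL> = \<UU> \<and>
    induced_on (block_kernel K \<LL>) L = Bij L \<and>
    perm_isomorphic (carrier G) K
      (L \<times> \<LL>) (imprimitive_wreath L (Bij L) \<LL> (block_action K \<LL>))"
proof -
  interpret A: almost_simple_overgroup G K
    using assms by (intro almost_simple_overgroup.intro permutation_group.intro almost_simple_overgroup_axioms.intro)
  have sys: "L = minimal_block G K" "\<LL> = A.P" "\<UU> = block_system K (upper_block G K)"
    using assms(7) by (auto simp: principal_section_def minimal_system_def upper_system_def)
  have tc: "has_three_cycles A.N A.L"
    using A.three_cycles_L[OF A.symmetric_type_alternating[OF assms(4,6)]] .
  have card: "card A.L \<ge> 4"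
    using A.card_L by simp
  have full: "\<sigma> \<in> A.N" if "\<sigma> \<in> Bij (carrier G)" "\<And>X. X \<in> A.P \<Longrightarrow> \<sigma> ` X = X" for \<sigma>
    using A.block_fixing_mem_if_two_closed[OF assms(1,4) tc card A.no_common_fixed_point that] .
  \<comment> \<open>Only \<open>L\<close> is linked to itself, so the union defining the upper block
    is \<open>L\<close> and the two systems coincide.\<close>
  have "linked_blocks K A.P A.L X \<longleftrightarrow> X = A.L" if X: "X \<in> A.P" for X
  proof (rule A.linked_blocks_iff)
    show "finite X"
      using finite_subset[OF A.P_subset[OF X] assms(1)] .
    show "card X \<ge> 2"
      using A.card_P[OF X] card by simp
  qed (use full X in auto)
  then have "{X \<in> A.P. linked_blocks K A.P A.L X} = {A.L}"
    using A.B_in_P by blast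
  then have "upper_block G K = A.L"
    by (simp add: upper_block_def minimal_system_def)
  moreover have "induced_on A.N A.L = Bij A.L"
    using full by (rule A.induced_on_kernel_block)
  moreover have "perm_isomorphic (carrier G) K
      (A.L \<times> A.P) (imprimitive_wreath A.L (Bij A.L) A.P (block_action K A.P))"
    using full by (rule A.perm_isomorphic_imprimitive_wreath)
  ultimately show ?thesis
    by (simp add: sys)
qed

end
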